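(* Let $k$ be an infinite field and let $$R=\frac{k[x_1,x_2,x_3,x_4,y_1,y_2,y_3,y_4]}{(x_1,x_2,x_3,x_4)^2+(y_1,y_2,y_3,y_4)^2+I},$$ $$I=(x_1,x_2)(y_3,y_4)+(x_3,x_4)(y_1,y_2)+\Big(\big(\textstyle\sum_{i=1}^4x_i\big)\big(\sum_{j=1}^4y_j\big)\Big).$$ Then $R$ does not have exact zero divisors, but $R$ has non-free totally reflexive modules.
   Context: A pair of exact zero divisors in a ring $A$ is a pair of elements $a,b\in A$, both non-units, with $\mathrm{Ann}_A(a)=(b)$ and $\mathrm{Ann}_A(b)=(a)$; $A$ "does not have exact zero divisors" if no such pair exists. A finitely generated $A$-module $M$ is called totally reflexive if there is an infinite complex of finitely generated free $A$-modules $F:\ \cdots\to F_1\to F_0\to F_{-1}\to\cdots$ such that $M\cong\mathrm{Coker}(F_1\to F_0)$ and both $F$ and $\mathrm{Hom}_A(F,A)$ are exact. *)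

theory Defs
  imports
    "HOL-Library.Poly_Mapping"
    "HOL-Algebra.Module"
    "HOL-Algebra.Ideal_Product"
    "HOL-Algebra.QuotRing"
    "HOL-Algebra.Algebraic_Closure_Type"
begin

section \<open>Exact zero divisors\<close>

definition annihilator :: "('a, 'm) ring_scheme \<Rightarrow> 'a \<Rightarrow> 'a set" where
  "annihilator A a = {c \<in> carrier A. c \<otimes>\<^bsub>A\<^esub> a = \<zero>\<^bsub>A\<^esub>}"

definition exact_zero_divisor_pair :: "('a, 'm) ring_scheme \<Rightarrow> 'a \<Rightarrow> 'a \<Rightarrow> bool" where
  "exact_zero_divisor_pair A a b \<longleftrightarrow>
     a \<in> carrier A \<and> b \<in> carrier A \<and> a \<notin> Units A \<and> b \<notin> Units A \<and>
     annihilator A a = PIdl\<^bsub>A\<^esub> b \<and> annihilator A b = PIdl\<^bsub>A\<^esub> a"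

definition has_exact_zero_divisors :: "('a, 'm) ring_scheme \<Rightarrow> bool" where
  "has_exact_zero_divisors A \<longleftrightarrow> (\<exists>a b. exact_zero_divisor_pair A a b)"


section \<open>Modules\<close>

definition finitely_generated_module :: "('a, 'm) ring_scheme \<Rightarrow> ('a, 'b) module \<Rightarrow> bool" where
  "finitely_generated_module A M \<longleftrightarrow> module A M \<and>
     (\<exists>S. finite S \<and> S \<subseteq> carrier M \<and>
        (\<forall>x\<in>carrier M. \<exists>c\<in>S \<rightarrow> carrier A. x = (\<Oplus>\<^bsub>M\<^esub>s\<in>S. c s \<odot>\<^bsub>M\<^esub> s)))"

definition coefficient_families :: "('a, 'm) ring_scheme \<Rightarrow> 'b set \<Rightarrow> ('b \<Rightarrow> 'a) set" where
  "coefficient_families A B = {c \<in> B \<rightarrow>\<^sub>E carrier A. finite {b \<in> B. c b \<noteq> \<zero>\<^bsub>A\<^esub>}}"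

definition module_basis :: "('a, 'm) ring_scheme \<Rightarrow> ('a, 'b) module \<Rightarrow> 'b set \<Rightarrow> bool" where
  "module_basis A M B \<longleftrightarrow> B \<subseteq> carrier M \<and>
     (\<forall>x\<in>carrier M. \<exists>!c. c \<in> coefficient_families A B \<and>
        x = (\<Oplus>\<^bsub>M\<^esub>b\<in>{b \<in> B. c b \<noteq> \<zero>\<^bsub>A\<^esub>}. c b \<odot>\<^bsub>M\<^esub> b))"

definition free_module :: "('a, 'm) ring_scheme \<Rightarrow> ('a, 'b) module \<Rightarrow> bool" where
  "free_module A M \<longleftrightarrow> module A M \<and> (\<exists>B. module_basis A M B)"

text \<open>Homomorphisms are extensional, so that they correspond to set-theoretic maps on the
  carriers and the homomorphisms between two modules themselves form a module.\<close>

definition module_homs ::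
    "('a, 'm) ring_scheme \<Rightarrow> ('a, 'b) module \<Rightarrow> ('a, 'c) module \<Rightarrow> ('b \<Rightarrow> 'c) set" where
  "module_homs A M N = {f \<in> carrier M \<rightarrow>\<^sub>E carrier N.
     (\<forall>x\<in>carrier M. \<forall>y\<in>carrier M. f (x \<oplus>\<^bsub>M\<^esub> y) = f x \<oplus>\<^bsub>N\<^esub> f y) \<and>
     (\<forall>a\<in>carrier A. \<forall>x\<in>carrier M. f (a \<odot>\<^bsub>M\<^esub> x) = a \<odot>\<^bsub>N\<^esub> f x)}"

definition module_isomorphic ::
    "('a, 'm) ring_scheme \<Rightarrow> ('a, 'b) module \<Rightarrow> ('a, 'c) module \<Rightarrow> bool" where
  "module_isomorphic A M N \<longleftrightarrow> (\<exists>f\<in>module_homs A M N. bij_betw f (carrier M) (carrier N))"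

text \<open>The record type of modules extends that of rings; the fields \<open>monoid.mult\<close> and \<open>one\<close> carry
  no meaning for a module and are left undefined here.\<close>

definition Hom_module ::
    "('a, 'm) ring_scheme \<Rightarrow> ('a, 'b) module \<Rightarrow> ('a, 'c) module \<Rightarrow> ('a, 'b \<Rightarrow> 'c) module" where
  "Hom_module A M N =
     \<lparr>carrier = module_homs A M N, monoid.mult = undefined, one = undefined,
      zero = (\<lambda>x\<in>carrier M. \<zero>\<^bsub>N\<^esub>),
      add = (\<lambda>f g. \<lambda>x\<in>carrier M. f x \<oplus>\<^bsub>N\<^esub> g x),
      module.smult = (\<lambda>a f. \<lambda>x\<in>carrier M. a \<odot>\<^bsub>N\<^esub> f x)\<rparr>"

definition quotient_module :: "('a, 'b) module \<Rightarrow> 'b set \<Rightarrow> ('a, 'b set) module" where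
  "quotient_module M N =
     \<lparr>carrier = a_rcosets\<^bsub>M\<^esub> N, monoid.mult = undefined, one = undefined,
      zero = N,
      add = set_add M,
      module.smult = (\<lambda>a C. \<Union>x\<in>C. N +>\<^bsub>M\<^esub> (a \<odot>\<^bsub>M\<^esub> x))\<rparr>"

definition cokernel ::
    "('a, 'b) module \<Rightarrow> ('a, 'c) module \<Rightarrow> ('b \<Rightarrow> 'c) \<Rightarrow> ('a, 'c set) module" where
  "cokernel M N f = quotient_module N (f ` carrier M)"

definition regular_module :: "('a, 'm) ring_scheme \<Rightarrow> ('a, 'a) module" where
  "regular_module A =
     \<lparr>carrier = carrier A, monoid.mult = monoid.mult A, one = one A, zero = zero A, add = add A,
      module.smult = monoid.mult A\<rparr>"

abbreviation dual_module :: "('a, 'm) ring_scheme \<Rightarrow> ('a, 'b) module \<Rightarrow> ('a, 'b \<Rightarrow> 'a) module" where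
  "dual_module A M \<equiv> Hom_module A M (regular_module A)"

text \<open>For \<open>f : M \<rightarrow> N\<close>, the induced map \<open>Hom(N, A) \<rightarrow> Hom(M, A)\<close> restricted to its domain.\<close>

definition dual_map ::
    "('a, 'm) ring_scheme \<Rightarrow> ('a, 'b) module \<Rightarrow> ('a, 'c) module \<Rightarrow> ('b \<Rightarrow> 'c) \<Rightarrow>
     ('c \<Rightarrow> 'a) \<Rightarrow> ('b \<Rightarrow> 'a)" where
  "dual_map A M N f = (\<lambda>g\<in>carrier (dual_module A N). compose (carrier M) g f)"

definition exact_at ::
    "('a, 'b) module \<Rightarrow> ('b \<Rightarrow> 'c) \<Rightarrow> ('a, 'c) module \<Rightarrow> ('c \<Rightarrow> 'd) \<Rightarrow> ('a, 'd) module \<Rightarrow> bool" where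
  "exact_at L f M g N \<longleftrightarrow> f ` carrier L = a_kernel M N g"


section \<open>Totally reflexive modules\<close>

text \<open>The differential \<open>d i\<close> goes from \<open>F i\<close> to \<open>F (i - 1)\<close>; exactness includes \<open>d\<^sup>2 = 0\<close>.\<close>

definition exact_complex ::
    "('a, 'm) ring_scheme \<Rightarrow> (int \<Rightarrow> ('a, 'b) module) \<Rightarrow> (int \<Rightarrow> 'b \<Rightarrow> 'b) \<Rightarrow> bool" where
  "exact_complex A F d \<longleftrightarrow>
     (\<forall>i. d i \<in> module_homs A (F i) (F (i - 1))) \<and>
     (\<forall>i. exact_at (F (i + 1)) (d (i + 1)) (F i) (d i) (F (i - 1)))"

definition dual_complex_exact ::
    "('a, 'm) ring_scheme \<Rightarrow> (int \<Rightarrow> ('a, 'b) module) \<Rightarrow> (int \<Rightarrow> 'b \<Rightarrow> 'b) \<Rightarrow> bool" where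
  "dual_complex_exact A F d \<longleftrightarrow>
     (\<forall>i. exact_at
        (dual_module A (F (i - 1))) (dual_map A (F i) (F (i - 1)) (d i))
        (dual_module A (F i)) (dual_map A (F (i + 1)) (F i) (d (i + 1)))
        (dual_module A (F (i + 1))))"

text \<open>A quantified module needs a fixed carrier type. The type \<open>nat \<Rightarrow> 'a\<close> contains
  \<open>A\<^sup>n = {..<n} \<rightarrow>\<^sub>E carrier A\<close> for every \<open>n\<close>, hence an isomorphic copy of every finitely
  generated free module. Consequently every totally reflexive module is isomorphic to one with
  carrier type \<open>(nat \<Rightarrow> 'a) set\<close>, that of the cokernel.\<close>

definition totally_reflexive :: "('a, 'm) ring_scheme \<Rightarrow> ('a, 'b) module \<Rightarrow> bool" where
  "totally_reflexive A M \<longleftrightarrow> finitely_generated_module A M \<and>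
     (\<exists>(F :: int \<Rightarrow> ('a, nat \<Rightarrow> 'a) module) d.
        (\<forall>i. finitely_generated_module A (F i) \<and> free_module A (F i)) \<and>
        exact_complex A F d \<and>
        dual_complex_exact A F d \<and>
        module_isomorphic A M (cokernel (F 1) (F 0) (d 1)))"


section \<open>The ring\<close>

datatype var = X1 | X2 | X3 | X4 | Y1 | Y2 | Y3 | Y4

text \<open>A polynomial maps monomials, given by their exponent vectors, to coefficients; the
  library's product on \<open>\<Rightarrow>\<^sub>0\<close> is convolution.\<close>

type_synonym 'k mpoly8 = "(var \<Rightarrow>\<^sub>0 nat) \<Rightarrow>\<^sub>0 'k"

definition pvar :: "var \<Rightarrow> 'k::field mpoly8" where
  "pvar v = Poly_Mapping.single (Poly_Mapping.single v 1) 1"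

definition polynomial_ring :: "'k::field mpoly8 ring" where
  "polynomial_ring = ring_of_type_algebra"

abbreviation gen_ideal :: "'k::field mpoly8 set \<Rightarrow> 'k mpoly8 set" where
  "gen_ideal S \<equiv> Idl\<^bsub>polynomial_ring\<^esub> S"

definition ideal_I :: "'k::field mpoly8 set" where
  "ideal_I =
     (gen_ideal {pvar X1, pvar X2} \<cdot>\<^bsub>polynomial_ring\<^esub> gen_ideal {pvar Y3, pvar Y4})
     <+>\<^bsub>polynomial_ring\<^esub>
     (gen_ideal {pvar X3, pvar X4} \<cdot>\<^bsub>polynomial_ring\<^esub> gen_ideal {pvar Y1, pvar Y2})
     <+>\<^bsub>polynomial_ring\<^esub>
     gen_ideal {(pvar X1 + pvar X2 + pvar X3 + pvar X4) * (pvar Y1 + pvar Y2 + pvar Y3 + pvar Y4)}"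

definition ideal_x :: "'k::field mpoly8 set" where
  "ideal_x = gen_ideal {pvar X1, pvar X2, pvar X3, pvar X4}"

definition ideal_y :: "'k::field mpoly8 set" where
  "ideal_y = gen_ideal {pvar Y1, pvar Y2, pvar Y3, pvar Y4}"

definition defining_ideal :: "'k::field mpoly8 set" where
  "defining_ideal =
     (ideal_x \<cdot>\<^bsub>polynomial_ring\<^esub> ideal_x)
     <+>\<^bsub>polynomial_ring\<^esub> (ideal_y \<cdot>\<^bsub>polynomial_ring\<^esub> ideal_y)
     <+>\<^bsub>polynomial_ring\<^esub> ideal_I"

definition ring_R :: "'k::field mpoly8 set ring" where
  "ring_R = polynomial_ring Quot defining_ideal"

end

theory Submission
  imports Defs
begin

text \<open>Split the variables into two blocks, \<open>X1, X2, Y1, Y2\<close> and \<open>X3, X4, Y3, Y4\<close>. In degree two the relations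
kill every product of two \<open>X\<close>'s, of two \<open>Y\<close>'s, and of an \<open>X\<close> and a \<open>Y\<close> from different blocks. Eight
monomials survive, and the last generator makes their sum zero; every monomial of degree three
vanishes. So a polynomial is zero in \<open>R\<close> iff its constant and linear coefficients vanish and
its eight surviving quadratic coefficients are all equal (\<open>defining_ideal_iff\<close>). This criterion turns
all questions about \<open>R\<close> into linear algebra on coefficients.

There are no exact zero divisors. Let \<open>a\<close> be a non-unit with linear part \<open>u1 + v1 + u2 + v2\<close>, where \<open>ui\<close> is
the \<open>X\<close>-part and \<open>vi\<close> the \<open>Y\<close>-part in block \<open>i\<close>. Then \<open>u1 - v1\<close> and \<open>u2 - v2\<close> both annihilate \<open>a\<close>; if one
of them is zero, two variables of that block annihilate \<open>a\<close> instead. Either way the annihilator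
contains two elements with linearly independent linear parts, whereas the linear parts in the ideal generated
by one non-unit all lie on a line (\<open>not_exact_zero_divisor\<close>).

For the module, let \<open>s\<close> and \<open>t\<close> be the sums of all \<open>X\<close>'s and of all \<open>Y\<close>'s, let \<open>x = X1 + X3\<close> and \<open>y = Y1 + Y3\<close>, and
consider the matrix with rows \<open>(s + t, x + y)\<close> and \<open>(y - x, s)\<close>. Its determinant is \<open>st + s\<^sup>2 + x\<^sup>2 - y\<^sup>2\<close>, which is zero
in \<open>R\<close>, so the matrix and its adjugate compose to zero in both orders. Before the relation
\<open>st = 0\<close> is imposed, both matrices map pairs of linear forms bijectively to pairs of quadratic forms; therefore
imposing it creates no more kernel than the image of the other matrix
(\<open>kernel_in_image\<close>, \<open>ring_R_adjugate_pair\<close>). Alternating the two matrices gives an exact complex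
of free modules of rank two. The transpose of a two-by-two matrix is conjugate to its adjugate,
so the dual complex is exact for the same reason, over any commutative ring
(\<open>dual_exact_mat_adj\<close>, \<open>coker_totally_reflexive\<close>). The cokernel is
not free, because the nonzero element \<open>X1 Y1\<close> of \<open>R\<close> annihilates it: it annihilates all entries of the adjugate,
so it maps every vector into the kernel of the adjugate, which is the image of the matrix (\<open>coker_not_free\<close>).\<close>

section \<open>Low-degree coefficients\<close>

definition mono1 :: "var \<Rightarrow> (var \<Rightarrow>\<^sub>0 nat)" where
  "mono1 v = Poly_Mapping.single v 1"

lemma lookup_mono1: "Poly_Mapping.lookup (mono1 v) w = (if v = w then 1 else 0)"
  by (simp add: mono1_def lookup_single when_def)

lemma pvar_eq_mono1: "pvar v = Poly_Mapping.single (mono1 v) 1"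
  by (simp add: pvar_def mono1_def)

text \<open>The coefficients of degree at most two. Together they form a truncated Taylor expansion, with the product rules
\<open>cst_mult\<close>, \<open>lin_mult\<close> and \<open>quad_mult\<close>.\<close>

definition cst :: "'k::field mpoly8 \<Rightarrow> 'k" where
  "cst p = Poly_Mapping.lookup p 0"
definition lin :: "'k::field mpoly8 \<Rightarrow> var \<Rightarrow> 'k" where
  "lin p v = Poly_Mapping.lookup p (mono1 v)"
definition quad :: "'k::field mpoly8 \<Rightarrow> var \<Rightarrow> var \<Rightarrow> 'k" where
  "quad p v w = Poly_Mapping.lookup p (mono1 v + mono1 w)"

lemma lookup_times_decomp:
  fixes f g :: "'a::monoid_add \<Rightarrow>\<^sub>0 'b::semiring_0"
  assumes "finite D" and D: "\<And>l q. l + q = k \<longleftrightarrow> (l, q) \<in> D"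
  shows "Poly_Mapping.lookup (f * g) k
    = (\<Sum>(l, q)\<in>D. Poly_Mapping.lookup f l * Poly_Mapping.lookup g q)"
proof -
  have "Poly_Mapping.lookup (f * g) k
      = prod_fun (Poly_Mapping.lookup f) (Poly_Mapping.lookup g) k"
    by (simp add: times_poly_mapping.rep_eq)
  also have "\<dots> = (\<Sum>(l, q). Poly_Mapping.lookup f l * Poly_Mapping.lookup g q when k = l + q)"
    by (rule prod_fun_unfold_prod) auto
  also have "\<dots> = (\<Sum>(l, q)\<in>D. Poly_Mapping.lookup f l * Poly_Mapping.lookup g q when k = l + q)"
    by (rule Sum_any.expand_superset) (use assms(1) in \<open>auto simp: when_def D[symmetric] split: if_splits\<close>)
  also have "\<dots> = (\<Sum>(l, q)\<in>D. Poly_Mapping.lookup f l * Poly_Mapping.lookup g q)"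
    by (rule sum.cong) (auto simp: when_def D[symmetric])
  finally show ?thesis .
qed

lemma mono_minus:
  assumes "Poly_Mapping.lookup m v > 0"
  shows "m = mono1 v + (m - mono1 v)"
  by (rule poly_mapping_eqI)
    (use assms in \<open>auto simp: lookup_add lookup_minus lookup_mono1\<close>)

lemma mono_plus_eq_0: "l + q = (0 :: var \<Rightarrow>\<^sub>0 nat) \<longleftrightarrow> (l, q) \<in> {(0, 0)}"
  by (auto simp: poly_mapping_eq_iff fun_eq_iff lookup_add)

text \<open>A variable dividing a product of monomials divides one of the factors. Iterated, this lists all factorizations
of a monomial of degree at most two, which are the terms of the corresponding coefficient of a product.\<close>

lemma mono_plus_eq_mono1_plus:
  "l + q = mono1 v + k \<longleftrightarrow>
    (\<exists>l'. l = mono1 v + l' \<and> l' + q = k) \<or> (\<exists>q'. q = mono1 v + q' \<and> l + q' = k)"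
proof
  assume eq: "l + q = mono1 v + k"
  have "Poly_Mapping.lookup l v + Poly_Mapping.lookup q v > 0"
    using arg_cong[OF eq, of "\<lambda>m. Poly_Mapping.lookup m v"] by (simp add: lookup_add lookup_mono1)
  then consider "Poly_Mapping.lookup l v > 0" | "Poly_Mapping.lookup q v > 0" by linarith
  then show "(\<exists>l'. l = mono1 v + l' \<and> l' + q = k) \<or> (\<exists>q'. q = mono1 v + q' \<and> l + q' = k)"
  proof cases
    case 1
    from mono_minus[OF this] eq show ?thesis by (metis add.assoc add_left_cancel)
  next
    case 2
    from mono_minus[OF this] eq show ?thesis by (metis add.left_commute add_left_cancel)
  qed
qed (auto simp: ac_simps)

lemma mono_plus_eq_mono1:
  "l + q = mono1 v \<longleftrightarrow> (l, q) \<in> {(mono1 v, 0), (0, mono1 v)}"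
  using mono_plus_eq_mono1_plus[of l q v 0] by (auto simp: mono_plus_eq_0)

lemma mono_plus_eq_mono2:
  "l + q = mono1 v + mono1 w \<longleftrightarrow>
    (l, q) \<in> {(mono1 v + mono1 w, 0), (0, mono1 v + mono1 w), (mono1 v, mono1 w), (mono1 w, mono1 v)}"
  using mono_plus_eq_mono1_plus[of l q v "mono1 w"] by (auto simp: mono_plus_eq_mono1)

lemma mono1_eq_iff [simp]: "mono1 v = mono1 w \<longleftrightarrow> v = w"
  by (metis lookup_mono1 zero_neq_one)

lemma mono1_nonzero: "mono1 v \<noteq> 0"
  by (metis lookup_mono1 lookup_zero zero_neq_one)

lemma mono1_neq_0 [simp]: "mono1 v \<noteq> 0" "mono1 v + m \<noteq> 0" "0 \<noteq> mono1 v" "0 \<noteq> mono1 v + m"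
  using mono_plus_eq_0[of "mono1 v" m] mono1_nonzero by auto

lemma mono2_neq_mono1 [simp]: "mono1 v + mono1 w \<noteq> mono1 u" "mono1 u \<noteq> mono1 v + mono1 w"
  using mono_plus_eq_mono1[of "mono1 v" "mono1 w" u] by auto

lemma cst_simps [simp]:
  "cst 0 = 0" "cst 1 = 1" "cst (p + q) = cst p + cst q" "cst (p - q) = cst p - cst q" "cst (- p) = - cst p"
  "cst (Poly_Mapping.single 0 c) = c" "cst (Poly_Mapping.single (mono1 v) c) = 0" "cst (pvar v) = 0"
  by (simp_all add: cst_def pvar_eq_mono1 lookup_add lookup_minus lookup_one lookup_single)

lemma lin_simps [simp]:
  "lin 0 v = 0" "lin 1 v = 0" "lin (p + q) v = lin p v + lin q v" "lin (p - q) v = lin p v - lin q v"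
  "lin (- p) v = - lin p v" "lin (Poly_Mapping.single 0 c) v = 0"
  "lin (Poly_Mapping.single (mono1 w) c) v = (if v = w then c else 0)"
  "lin (pvar w) v = (if v = w then 1 else 0)"
  by (auto simp add: lin_def pvar_eq_mono1 lookup_add lookup_minus lookup_one lookup_single when_def)

lemma quad_simps [simp]:
  "quad 0 v w = 0" "quad 1 v w = 0" "quad (p + q) v w = quad p v w + quad q v w"
  "quad (p - q) v w = quad p v w - quad q v w"
  "quad (- p) v w = - quad p v w" "quad (Poly_Mapping.single 0 c) v w = 0"
  "quad (Poly_Mapping.single (mono1 u) c) v w = 0" "quad (pvar u) v w = 0"
  by (auto simp add: quad_def pvar_eq_mono1 lookup_add lookup_minus lookup_one lookup_single when_def)

lemma cst_mult [simp]: "cst (p * q) = cst p * cst q"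
  unfolding cst_def by (subst lookup_times_decomp[OF _ mono_plus_eq_0]) auto

lemma lin_mult [simp]: "lin (p * q) v = lin p v * cst q + cst p * lin q v"
  unfolding cst_def lin_def by (subst lookup_times_decomp[OF _ mono_plus_eq_mono1]) auto

lemma quad_mult:
  assumes "v \<noteq> w"
  shows "quad (p * q) v w = quad p v w * cst q + cst p * quad q v w + lin p v * lin q w + lin p w * lin q v"
  unfolding cst_def lin_def quad_def
  by (subst lookup_times_decomp[OF _ mono_plus_eq_mono2]) (use assms in auto)

section \<open>The ideal of relations\<close>

lemma polynomial_ring_simps [simp]:
  "carrier polynomial_ring = UNIV" "p \<otimes>\<^bsub>polynomial_ring\<^esub> q = p * q" "p \<oplus>\<^bsub>polynomial_ring\<^esub> q = p + q"
  "\<zero>\<^bsub>polynomial_ring\<^esub> = 0" "\<one>\<^bsub>polynomial_ring\<^esub> = 1"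
  by (simp_all add: polynomial_ring_def ring_of_type_algebra_def)

interpretation P: cring polynomial_ring
  unfolding polynomial_ring_def by (rule cring_from_type_algebra)

lemma ideal_polynomial_ringI:
  assumes "0 \<in> K" "\<And>p q. p \<in> K \<Longrightarrow> q \<in> K \<Longrightarrow> p + q \<in> K" "\<And>r p. p \<in> K \<Longrightarrow> r * p \<in> K"
  shows "ideal K polynomial_ring"
proof (rule idealI[OF P.ring_axioms])
  show "subgroup K (add_monoid polynomial_ring)"
  proof (rule P.add.subgroupI)
    fix p assume p: "p \<in> K"
    have "\<ominus>\<^bsub>polynomial_ring\<^esub> p = - 1 * p"
      using P.l_minus[of "1" p] by (intro P.minus_equality) auto
    then show "\<ominus>\<^bsub>polynomial_ring\<^esub> p \<in> K" using assms(3)[OF p, of "-1"] by simp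
  qed (use assms in auto)
qed (use assms(3) in \<open>auto simp: mult.commute\<close>)

lemma ideal_polynomial_ringD:
  assumes "ideal K polynomial_ring"
  shows "0 \<in> K" "\<And>p q. p \<in> K \<Longrightarrow> q \<in> K \<Longrightarrow> p + q \<in> K" "\<And>r p. p \<in> K \<Longrightarrow> r * p \<in> K"
proof -
  interpret ideal K polynomial_ring by (rule assms)
  show "0 \<in> K" using zero_closed by simp
  show "p + q \<in> K" if "p \<in> K" "q \<in> K" for p q using a_closed[OF that] by simp
  show "r * p \<in> K" if "p \<in> K" for r p using I_l_closed[OF that, of r] by simp
qed

lemma gen_ideal_ideal: "ideal (gen_ideal S) polynomial_ring"
  by (rule P.genideal_ideal) simp

lemma gen_ideal_self: "p \<in> S \<Longrightarrow> p \<in> gen_ideal S"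
  using P.genideal_self[of S] by auto

text \<open>It suffices to check products of generators: being multiplied into \<open>K\<close> by a fixed set of elements is an ideal
condition, so it passes from generators to ideals in one factor and then in the other.\<close>

lemma gen_ideal_prod_subset:
  assumes K: "ideal K polynomial_ring" and ST: "\<And>p q. p \<in> S \<Longrightarrow> q \<in> T \<Longrightarrow> p * q \<in> K"
  shows "gen_ideal S \<cdot>\<^bsub>polynomial_ring\<^esub> gen_ideal T \<subseteq> K"
proof -
  note Kc = ideal_polynomial_ringD[OF K]
  have "ideal {p. \<forall>q\<in>T. p * q \<in> K} polynomial_ring"
    using Kc by (intro ideal_polynomial_ringI) (auto simp: distrib_right mult.assoc)
  then have S: "gen_ideal S \<subseteq> {p. \<forall>q\<in>T. p * q \<in> K}"
    by (rule P.genideal_minimal) (use ST in auto)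
  have "ideal {q. \<forall>p\<in>gen_ideal S. p * q \<in> K} polynomial_ring"
    using Kc by (intro ideal_polynomial_ringI) (auto simp: distrib_left mult.left_commute)
  then have T: "gen_ideal T \<subseteq> {q. \<forall>p\<in>gen_ideal S. p * q \<in> K}"
    by (rule P.genideal_minimal) (use S in auto)
  show ?thesis
  proof
    fix r assume "r \<in> gen_ideal S \<cdot>\<^bsub>polynomial_ring\<^esub> gen_ideal T"
    then show "r \<in> K" by induction (use T Kc in auto)
  qed
qed

lemma prod_mem_gen_ideal_prod:
  "p \<in> S \<Longrightarrow> q \<in> T \<Longrightarrow> p * q \<in> gen_ideal S \<cdot>\<^bsub>polynomial_ring\<^esub> gen_ideal T"
  using ideal_prod.prod[of p "gen_ideal S" q "gen_ideal T" polynomial_ring] gen_ideal_self by auto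

lemma set_add_subset:
  assumes "ideal K polynomial_ring" "A \<subseteq> K" "B \<subseteq> K"
  shows "A <+>\<^bsub>polynomial_ring\<^esub> B \<subseteq> K"
  using ideal_polynomial_ringD(2)[OF assms(1)] assms(2,3) by (auto simp: set_add_defs)

lemma set_add_memI:
  assumes "ideal A polynomial_ring" "ideal B polynomial_ring"
  shows "p \<in> A \<Longrightarrow> p \<in> A <+>\<^bsub>polynomial_ring\<^esub> B" "p \<in> B \<Longrightarrow> p \<in> A <+>\<^bsub>polynomial_ring\<^esub> B"
  using ideal_polynomial_ringD(1)[OF assms(1)] ideal_polynomial_ringD(1)[OF assms(2)]
  by (force simp: set_add_defs)+

definition surviving_pairs :: "(var \<times> var) set" where
  "surviving_pairs = {X1, X2} \<times> {Y1, Y2} \<union> {X3, X4} \<times> {Y3, Y4}"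

text \<open>The equations for membership in the ideal of relations. The surviving quadratic coefficients need
not vanish, since the sum of the surviving monomials is itself a relation.\<close>

definition vanishing_jet :: "'k::field mpoly8 \<Rightarrow> bool" where
  "vanishing_jet p \<longleftrightarrow> cst p = 0 \<and> (\<forall>v. lin p v = 0) \<and> (\<exists>c. \<forall>(v, w)\<in>surviving_pairs. quad p v w = c)"

lemma surviving_pairs_neq: "(v, w) \<in> surviving_pairs \<Longrightarrow> v \<noteq> w"
  by (auto simp: surviving_pairs_def)

lemma vanishing_jetI:
  assumes "cst p = 0" "\<And>v. lin p v = 0" "\<And>v w. (v, w) \<in> surviving_pairs \<Longrightarrow> quad p v w = c"
  shows "vanishing_jet p"
  using assms by (auto simp: vanishing_jet_def)

lemma vanishing_jet_quad:
  "vanishing_jet p \<Longrightarrow> \<exists>c. \<forall>v w. (v, w) \<in> surviving_pairs \<longrightarrow> quad p v w = c"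
  unfolding vanishing_jet_def by blast

lemma ideal_vanishing_jet: "ideal {p. vanishing_jet p} polynomial_ring"
proof (rule ideal_polynomial_ringI, goal_cases)
  case 1 show ?case by (auto simp: vanishing_jet_def)
next
  case (2 p q)
  then obtain c d where "\<forall>(v, w)\<in>surviving_pairs. quad p v w = c" "\<forall>(v, w)\<in>surviving_pairs. quad q v w = d"
    by (auto simp: vanishing_jet_def)
  with 2 show ?case by (auto simp: vanishing_jet_def intro!: exI[of _ "c + d"])
next
  case (3 r p)
  then obtain c where "\<forall>(v, w)\<in>surviving_pairs. quad p v w = c"
    by (auto simp: vanishing_jet_def)
  with 3 have "vanishing_jet (r * p)"
    by (intro vanishing_jetI[where c = "cst r * c"])
      (auto simp: vanishing_jet_def quad_mult surviving_pairs_neq)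
  then show ?case by simp
qed

lemma defining_ideal_subset: "defining_ideal \<subseteq> {p. vanishing_jet p}"
  unfolding defining_ideal_def ideal_x_def ideal_y_def ideal_I_def
  by (intro set_add_subset gen_ideal_prod_subset P.genideal_minimal ideal_vanishing_jet)
    (auto intro!: vanishing_jetI simp: surviving_pairs_def quad_mult)

lemma ideal_defining_ideal: "ideal defining_ideal polynomial_ring"
  unfolding defining_ideal_def ideal_x_def ideal_y_def ideal_I_def
  by (intro P.add_ideals P.ideal_prod_is_ideal gen_ideal_ideal)

lemma defining_ideal_supset:
  "ideal_x \<cdot>\<^bsub>polynomial_ring\<^esub> ideal_x \<subseteq> defining_ideal"
  "ideal_y \<cdot>\<^bsub>polynomial_ring\<^esub> ideal_y \<subseteq> defining_ideal"
  "gen_ideal {pvar X1, pvar X2} \<cdot>\<^bsub>polynomial_ring\<^esub> gen_ideal {pvar Y3, pvar Y4} \<subseteq> defining_ideal"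
  "gen_ideal {pvar X3, pvar X4} \<cdot>\<^bsub>polynomial_ring\<^esub> gen_ideal {pvar Y1, pvar Y2} \<subseteq> defining_ideal"
  "gen_ideal {(pvar X1 + pvar X2 + pvar X3 + pvar X4) * (pvar Y1 + pvar Y2 + pvar Y3 + pvar Y4)} \<subseteq> defining_ideal"
proof -
  note I = P.add_ideals P.ideal_prod_is_ideal gen_ideal_ideal
  have L: "ideal A polynomial_ring \<Longrightarrow> ideal B polynomial_ring \<Longrightarrow> C \<subseteq> A \<Longrightarrow> C \<subseteq> A <+>\<^bsub>polynomial_ring\<^esub> B"
    and R: "ideal A polynomial_ring \<Longrightarrow> ideal B polynomial_ring \<Longrightarrow> C \<subseteq> B \<Longrightarrow> C \<subseteq> A <+>\<^bsub>polynomial_ring\<^esub> B" for A B C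
    using set_add_memI by blast+
  show "ideal_x \<cdot>\<^bsub>polynomial_ring\<^esub> ideal_x \<subseteq> defining_ideal"
    unfolding defining_ideal_def ideal_x_def ideal_y_def ideal_I_def by (rule L L[OF _ _ L] I order_refl)+
  show "ideal_y \<cdot>\<^bsub>polynomial_ring\<^esub> ideal_y \<subseteq> defining_ideal"
    unfolding defining_ideal_def ideal_x_def ideal_y_def ideal_I_def
    by (rule L, (rule I)+, rule R, (rule I)+, rule order_refl)
  show "gen_ideal {pvar X1, pvar X2} \<cdot>\<^bsub>polynomial_ring\<^esub> gen_ideal {pvar Y3, pvar Y4} \<subseteq> defining_ideal"
    unfolding defining_ideal_def ideal_x_def ideal_y_def ideal_I_def
    by (rule R, (rule I)+, rule L, (rule I)+, rule L, (rule I)+, rule order_refl)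
  show "gen_ideal {pvar X3, pvar X4} \<cdot>\<^bsub>polynomial_ring\<^esub> gen_ideal {pvar Y1, pvar Y2} \<subseteq> defining_ideal"
    unfolding defining_ideal_def ideal_x_def ideal_y_def ideal_I_def
    by (rule R, (rule I)+, rule L, (rule I)+, rule R, (rule I)+, rule order_refl)
  show "gen_ideal {(pvar X1 + pvar X2 + pvar X3 + pvar X4) * (pvar Y1 + pvar Y2 + pvar Y3 + pvar Y4)} \<subseteq> defining_ideal"
    unfolding defining_ideal_def ideal_x_def ideal_y_def ideal_I_def
    by (rule R, (rule I)+, rule R, (rule I)+, rule order_refl)
qed

lemma pvar_prod_mem:
  assumes "(v, w) \<notin> surviving_pairs" "(w, v) \<notin> surviving_pairs"
  shows "pvar v * pvar w \<in> (defining_ideal :: 'k::field mpoly8 set)"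
proof -
  note J = defining_ideal_supset(1-4)[unfolded ideal_x_def ideal_y_def, THEN subsetD, OF prod_mem_gen_ideal_prod]
  have "v \<in> {X1,X2,X3,X4} \<Longrightarrow> w \<in> {X1,X2,X3,X4} \<Longrightarrow> pvar v * pvar w \<in> (defining_ideal :: 'k::field mpoly8 set)"
    "v \<in> {Y1,Y2,Y3,Y4} \<Longrightarrow> w \<in> {Y1,Y2,Y3,Y4} \<Longrightarrow> pvar v * pvar w \<in> (defining_ideal :: 'k::field mpoly8 set)"
    "v \<in> {X1,X2} \<Longrightarrow> w \<in> {Y3,Y4} \<Longrightarrow> pvar v * pvar w \<in> (defining_ideal :: 'k::field mpoly8 set)"
    "w \<in> {X1,X2} \<Longrightarrow> v \<in> {Y3,Y4} \<Longrightarrow> pvar w * pvar v \<in> (defining_ideal :: 'k::field mpoly8 set)"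
    "v \<in> {X3,X4} \<Longrightarrow> w \<in> {Y1,Y2} \<Longrightarrow> pvar v * pvar w \<in> (defining_ideal :: 'k::field mpoly8 set)"
    "w \<in> {X3,X4} \<Longrightarrow> v \<in> {Y1,Y2} \<Longrightarrow> pvar w * pvar v \<in> (defining_ideal :: 'k::field mpoly8 set)"
    by (rule J; blast)+
  then have "pvar v * pvar w \<in> (defining_ideal :: 'k::field mpoly8 set) \<or> pvar w * pvar v \<in> (defining_ideal :: 'k::field mpoly8 set)"
    using assms by (cases v; cases w) (simp_all add: surviving_pairs_def)
  then show ?thesis by (simp add: mult.commute)
qed

text \<open>The shape in which a monomial of degree at least two occurs when its first two variables are split off.\<close>

lemma pvar_prod_eq: "pvar v * pvar w * Poly_Mapping.single m c = Poly_Mapping.single (mono1 v + (mono1 w + m)) c"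
  by (simp add: pvar_eq_mono1 mult_single add.assoc)

definition surviving_sum :: "'k::field mpoly8" where
  "surviving_sum = pvar X1 * pvar Y1 + pvar X1 * pvar Y2 + pvar X2 * pvar Y1 + pvar X2 * pvar Y2
     + pvar X3 * pvar Y3 + pvar X3 * pvar Y4 + pvar X4 * pvar Y3 + pvar X4 * pvar Y4"

lemma surviving_sum_mem: "surviving_sum \<in> (defining_ideal :: 'k::field mpoly8 set)"
proof -
  note J = ideal_polynomial_ringD[OF ideal_defining_ideal]
  define q :: "'k mpoly8" where "q = (pvar X1 + pvar X2 + pvar X3 + pvar X4) * (pvar Y1 + pvar Y2 + pvar Y3 + pvar Y4)"
  have q: "q \<in> defining_ideal" using defining_ideal_supset(5) gen_ideal_self unfolding q_def by blast
  have "surviving_sum = q + (-1) * (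
      pvar X1 * pvar Y3 + pvar X1 * pvar Y4 + pvar X2 * pvar Y3 + pvar X2 * pvar Y4
      + pvar X3 * pvar Y1 + pvar X3 * pvar Y2 + pvar X4 * pvar Y1 + pvar X4 * pvar Y2)"
    unfolding surviving_sum_def q_def by (simp add: distrib_left distrib_right)
  also have "\<dots> \<in> defining_ideal"
    by (intro J q pvar_prod_mem) (simp_all add: surviving_pairs_def)
  finally show ?thesis .
qed

lemma surviving_sum_jet:
  "cst surviving_sum = 0" "lin surviving_sum v = 0"
  "(v, w) \<in> surviving_pairs \<Longrightarrow> quad surviving_sum v w = 1"
proof -
  show "cst surviving_sum = 0" "lin surviving_sum v = 0"
    unfolding surviving_sum_def by simp_all
  show "quad surviving_sum v w = 1" if "(v, w) \<in> surviving_pairs"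
  proof -
    have "(v, w) \<in> {(X1,Y1), (X1,Y2), (X2,Y1), (X2,Y2), (X3,Y3), (X3,Y4), (X4,Y3), (X4,Y4)}"
      using that by (auto simp: surviving_pairs_def)
    then show ?thesis
      unfolding surviving_sum_def by (elim insertE emptyE; simp add: quad_mult)
  qed
qed

lemma mono_cases:
  obtains "m = 0" | v where "m = mono1 v" | v w m' where "m = mono1 v + (mono1 w + m')"
proof -
  have split: "\<exists>v k'. k = mono1 v + k'" if "k \<noteq> 0" for k :: "var \<Rightarrow>\<^sub>0 nat"
  proof -
    from that obtain v where "Poly_Mapping.lookup k v > 0" by (auto simp: poly_mapping_eq_iff fun_eq_iff)
    from mono_minus[OF this] show ?thesis by blast
  qed
  show thesis
  proof (cases "m = 0")
    case False
    then obtain v k where "m = mono1 v + k" using split by blast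
    then show thesis using split[of k] that(2)[of v] that(3)[of v] by (cases "k = 0") auto
  qed (rule that(1))
qed

text \<open>Apart from the surviving ones, all monomials of degree at least two are relations. In degree three or more, if the first
two variables form a surviving pair, then one is an \<open>X\<close> and the other a \<open>Y\<close>, so any third variable makes
a vanishing product with one of them.\<close>

lemma single_mem_defining_ideal:
  assumes "m \<noteq> 0" "\<And>v. m \<noteq> mono1 v" "\<And>v w. (v, w) \<in> surviving_pairs \<Longrightarrow> m \<noteq> mono1 v + mono1 w"
  shows "Poly_Mapping.single m c \<in> defining_ideal"
proof -
  note J = ideal_polynomial_ringD[OF ideal_defining_ideal]
  have nonsurviving: "Poly_Mapping.single (mono1 v + (mono1 w + m')) c \<in> defining_ideal"
    if "(v, w) \<notin> surviving_pairs" "(w, v) \<notin> surviving_pairs" for v w m'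
    using J(3)[OF pvar_prod_mem[OF that], of "Poly_Mapping.single m' c"]
    by (simp add: pvar_prod_eq mult.commute[of "Poly_Mapping.single m' c"])
  from assms(1,2) obtain v w m' where m: "m = mono1 v + (mono1 w + m')" by (metis mono_cases)
  show ?thesis
  proof (cases "(v, w) \<in> surviving_pairs \<or> (w, v) \<in> surviving_pairs")
    case True
    then have "m' \<noteq> 0" using assms(3)[of v w] assms(3)[of w v] m by (auto simp: add.commute)
    then obtain u k where m': "m' = mono1 u + k" by (metis mono_cases add.right_neutral)
    have "(v, u) \<notin> surviving_pairs \<and> (u, v) \<notin> surviving_pairs \<or> (w, u) \<notin> surviving_pairs \<and> (u, w) \<notin> surviving_pairs"
      using True by (cases u) (auto simp: surviving_pairs_def)
    moreover have "m = mono1 v + (mono1 u + (mono1 w + k))" "m = mono1 w + (mono1 u + (mono1 v + k))"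
      by (simp_all add: m m' ac_simps)
    ultimately show ?thesis using nonsurviving by metis
  next
    case False
    then show ?thesis using nonsurviving unfolding m by blast
  qed
qed

lemma poly_mem_defining_idealI:
  assumes "\<And>m. m \<in> Poly_Mapping.keys p \<Longrightarrow> Poly_Mapping.single m (Poly_Mapping.lookup p m) \<in> defining_ideal"
  shows "p \<in> defining_ideal"
proof -
  have sum_in_defining_ideal: "sum f S \<in> defining_ideal"
    if "finite S" "\<And>m. m \<in> S \<Longrightarrow> f m \<in> defining_ideal" for f and S :: "(var \<Rightarrow>\<^sub>0 nat) set"
    using that by (induction S rule: finite_induct) (auto intro: ideal_polynomial_ringD[OF ideal_defining_ideal])
  have "p = (\<Sum>m\<in>Poly_Mapping.keys p. Poly_Mapping.single m (Poly_Mapping.lookup p m))"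
  proof (rule poly_mapping_eqI)
    fix k
    show "Poly_Mapping.lookup p k
      = Poly_Mapping.lookup (\<Sum>m\<in>Poly_Mapping.keys p. Poly_Mapping.single m (Poly_Mapping.lookup p m)) k"
      by (cases "k \<in> Poly_Mapping.keys p") (simp_all add: lookup_sum lookup_single when_def in_keys_iff)
  qed
  also have "\<dots> \<in> defining_ideal"
    by (rule sum_in_defining_ideal) (use assms in auto)
  finally show ?thesis .
qed

text \<open>For the harder direction, subtracting a multiple of the sum of the surviving monomials clears all coefficients outside
the monomials covered by \<open>single_mem_defining_ideal\<close>.\<close>

lemma defining_ideal_iff: "p \<in> defining_ideal \<longleftrightarrow> vanishing_jet p"
proof
  assume "vanishing_jet p"
  then have p: "cst p = 0" "\<And>v. lin p v = 0" by (simp_all add: vanishing_jet_def)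
  obtain c where pc: "\<And>v w. (v, w) \<in> surviving_pairs \<Longrightarrow> quad p v w = c"
    using vanishing_jet_quad[OF \<open>vanishing_jet p\<close>] by blast
  note J = ideal_polynomial_ringD[OF ideal_defining_ideal]
  define r where "r = p - Poly_Mapping.single 0 c * surviving_sum"
  have r: "cst r = 0" "\<And>v. lin r v = 0"
    by (simp_all add: r_def p surviving_sum_jet)
  have r2: "quad r v w = 0" if "(v, w) \<in> surviving_pairs" for v w
    using that by (simp add: r_def p pc surviving_sum_jet quad_mult surviving_pairs_neq)
  have "r \<in> defining_ideal"
  proof (rule poly_mem_defining_idealI, rule single_mem_defining_ideal)
    fix m assume "m \<in> Poly_Mapping.keys r"
    then have m: "Poly_Mapping.lookup r m \<noteq> 0" by (simp add: in_keys_iff)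
    show "m \<noteq> 0" using m r(1) by (auto simp: cst_def)
    show "m \<noteq> mono1 v" for v using m r(2)[of v] by (auto simp: lin_def)
    show "m \<noteq> mono1 v + mono1 w" if "(v, w) \<in> surviving_pairs" for v w
      using m r2[OF that] by (auto simp: quad_def)
  qed
  from J(2)[OF this J(3)[OF surviving_sum_mem, of "Poly_Mapping.single 0 c"]]
  show "p \<in> defining_ideal" by (simp add: r_def)
qed (use defining_ideal_subset in auto)

section \<open>The quotient ring and its annihilators\<close>

lemma surviving_pairs_cases:
  assumes "(v, w) \<in> surviving_pairs"
  obtains "v = X1" "w = Y1" | "v = X1" "w = Y2" | "v = X2" "w = Y1" | "v = X2" "w = Y2"
    | "v = X3" "w = Y3" | "v = X3" "w = Y4" | "v = X4" "w = Y3" | "v = X4" "w = Y4"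
  using assms by (auto simp: surviving_pairs_def)

lemma lin_pvar_self: "lin (pvar v) v = 1"
  by simp

text \<open>The residue class map onto \<open>R\<close>. Computations take place between polynomial representatives and are transported along it.\<close>

definition cls :: "'k::field mpoly8 \<Rightarrow> 'k mpoly8 set" where
  "cls p = defining_ideal +>\<^bsub>polynomial_ring\<^esub> p"

lemma abelian_subgroup_defining_ideal: "abelian_subgroup defining_ideal polynomial_ring"
  by (rule abelian_subgroupI3[OF ideal.axioms(1)[OF ideal_defining_ideal] P.abelian_group_axioms])

interpretation R: cring ring_R
  unfolding ring_R_def by (rule ideal.quotient_is_cring[OF ideal_defining_ideal P.cring_axioms])

lemma cls_ring_hom: "cls \<in> ring_hom polynomial_ring ring_R"
  unfolding ring_R_def cls_def by (rule ideal.rcos_ring_hom[OF ideal_defining_ideal])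

lemma carrier_ring_R: "carrier ring_R = range cls"
  by (auto simp: ring_R_def FactRing_def A_RCOSETS_def' cls_def)

lemma cls_simps:
  "cls p \<otimes>\<^bsub>ring_R\<^esub> cls q = cls (p * q)" "cls p \<oplus>\<^bsub>ring_R\<^esub> cls q = cls (p + q)"
  "\<zero>\<^bsub>ring_R\<^esub> = cls 0" "\<one>\<^bsub>ring_R\<^esub> = cls 1" "cls p \<in> carrier ring_R"
proof -
  show "cls p \<otimes>\<^bsub>ring_R\<^esub> cls q = cls (p * q)" using ring_hom_mult[OF cls_ring_hom, of p q] by simp
  show "cls p \<oplus>\<^bsub>ring_R\<^esub> cls q = cls (p + q)" using ring_hom_add[OF cls_ring_hom, of p q] by simp
  show "\<one>\<^bsub>ring_R\<^esub> = cls 1" using ring_hom_one[OF cls_ring_hom, symmetric] by simp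
  show "\<zero>\<^bsub>ring_R\<^esub> = cls 0" using ring_hom_zero[OF cls_ring_hom P.ring_axioms R.ring_axioms, symmetric] by simp
  show "cls p \<in> carrier ring_R" by (simp add: carrier_ring_R)
qed

lemma cls_uminus: "\<ominus>\<^bsub>ring_R\<^esub> cls p = cls (- p)"
  by (rule R.minus_equality) (simp_all add: cls_simps)

lemma cls_eq_0_iff: "cls p = cls 0 \<longleftrightarrow> vanishing_jet p"
proof -
  have "cls p = cls 0 \<longleftrightarrow> p \<in> defining_ideal"
    using abelian_subgroup.a_rcos_const[OF abelian_subgroup_defining_ideal, of p]
      abelian_subgroup.a_rcos_const[OF abelian_subgroup_defining_ideal, of 0]
      abelian_subgroup.a_rcos_self[OF abelian_subgroup_defining_ideal, of p]
      ideal_polynomial_ringD(1)[OF ideal_defining_ideal]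
    by (auto simp: cls_def)
  then show ?thesis by (simp add: defining_ideal_iff)
qed

lemma cls_eq_iff: "cls p = cls q \<longleftrightarrow> vanishing_jet (p - q)"
proof -
  have "cls p = cls q \<longleftrightarrow> cls (p - q) = cls 0"
  proof
    assume "cls p = cls q"
    then have "cls p \<oplus>\<^bsub>ring_R\<^esub> cls (- q) = cls q \<oplus>\<^bsub>ring_R\<^esub> cls (- q)" by simp
    then show "cls (p - q) = cls 0" by (simp add: cls_simps)
  next
    assume "cls (p - q) = cls 0"
    then have "cls (p - q) \<oplus>\<^bsub>ring_R\<^esub> cls q = cls 0 \<oplus>\<^bsub>ring_R\<^esub> cls q" by simp
    then show "cls p = cls q" by (simp add: cls_simps)
  qed
  then show ?thesis by (simp add: cls_eq_0_iff)
qed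

text \<open>After scaling, the representative is \<open>1 - n\<close> with \<open>n\<close> in the maximal ideal, and \<open>n\<^sup>3 = 0\<close>, so \<open>1 + n + n\<^sup>2\<close> is
an inverse.\<close>

lemma cls_unit:
  assumes "cst p \<noteq> 0"
  shows "cls p \<in> Units ring_R"
proof -
  define c where "c = Poly_Mapping.single (0 :: var \<Rightarrow>\<^sub>0 nat) (1 / cst p)"
  define n where "n = 1 - c * p"
  have n: "cst n = 0" using assms by (simp add: n_def c_def)
  have "vanishing_jet (n * (n * n))"
    by (rule vanishing_jetI[where c = 0]) (simp_all add: n quad_mult surviving_pairs_neq)
  then have "cls (1 - n * (n * n)) = cls 1"
    using cls_eq_iff[of 1 "1 - n * (n * n)"] by simp
  moreover have "c * (1 + n + n * n) * p = 1 - n * (n * n)"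
  proof -
    have "c * (1 + n + n * n) * p = (c * p) * (1 + n + n * n)" by (simp only: ac_simps)
    also have "c * p = 1 - n" by (simp add: n_def)
    also have "(1 - n) * (1 + n + n * n) = 1 - n * (n * n)"
      by (simp add: left_diff_distrib distrib_left)
    finally show ?thesis .
  qed
  ultimately have "cls (c * (1 + n + n * n)) \<otimes>\<^bsub>ring_R\<^esub> cls p = \<one>\<^bsub>ring_R\<^esub>"
    by (simp only: cls_simps)
  moreover from this have "cls p \<otimes>\<^bsub>ring_R\<^esub> cls (c * (1 + n + n * n)) = \<one>\<^bsub>ring_R\<^esub>"
    by (subst R.m_comm) (simp_all only: cls_simps)
  ultimately show ?thesis using cls_simps(5) unfolding Units_def by blast
qed

lemma annihilator_cls: "cls z \<in> annihilator ring_R (cls p) \<longleftrightarrow> vanishing_jet (z * p)"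
  by (simp add: annihilator_def cls_simps cls_eq_0_iff)

text \<open>Without a constant term in \<open>q\<close>, only the constant term of a factor \<open>r\<close> reaches the linear part of \<open>r q\<close>.\<close>

lemma lin_of_multiple:
  assumes "cls z \<in> PIdl\<^bsub>ring_R\<^esub> (cls q)" "cst q = 0"
  obtains c where "\<And>v. lin z v = c * lin q v"
proof -
  from assms(1) obtain r where "cls z = cls (r * q)"
    by (auto simp: cgenideal_def carrier_ring_R cls_simps)
  then have "vanishing_jet (z - r * q)" by (simp add: cls_eq_iff)
  then have "lin z v = cst r * lin q v" for v using assms(2) by (auto simp: vanishing_jet_def)
  then show thesis by (rule that)
qed

text \<open>Two annihilators of \<open>p\<close> whose linear parts have disjoint supports cannot both have a nonzero linear
part, since these parts are multiples of one linear form. Any \<open>p\<close> has two such annihilators: the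
signed block parts of \<open>p\<close> or, if one of them is zero, two variables of the same block.\<close>

lemma not_exact_zero_divisor:
  fixes p q :: "'k::field mpoly8"
  assumes p: "cst p = 0" and q: "cst q = 0"
  shows "annihilator ring_R (cls p) \<noteq> PIdl\<^bsub>ring_R\<^esub> (cls q)"
proof
  assume eq: "annihilator ring_R (cls p) = PIdl\<^bsub>ring_R\<^esub> (cls q)"
  have proportional: "\<exists>c. \<forall>v. lin z v = c * lin q v" if "vanishing_jet (z * p)" for z
    using lin_of_multiple[of z q] that annihilator_cls[of z p] q unfolding eq by metis
  have disjoint: "(\<forall>v. lin z v = 0) \<or> (\<forall>v. lin z' v = 0)"
    if z: "vanishing_jet (z * p)" and z': "vanishing_jet (z' * p)" and v: "\<And>v. lin z v * lin z' v = 0" for z z'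
  proof -
    obtain c where c: "\<And>v. lin z v = c * lin q v" using proportional[OF z] by blast
    obtain d where d: "\<And>v. lin z' v = d * lin q v" using proportional[OF z'] by blast
    show ?thesis
    proof (cases "c = 0 \<or> d = 0")
      case True then show ?thesis using c d by auto
    next
      case False
      then have "lin q v = 0" for v using v[of v] by (simp add: c d)
      then show ?thesis by (simp add: c)
    qed
  qed
  \<comment> \<open>the differences of the \<open>X\<close>-part and the \<open>Y\<close>-part of \<open>p\<close> in the two blocks; in \<open>z p\<close> the mixed terms
    cancel in the block of \<open>z\<close> and are killed by the relations outside it\<close>
  define C where "C = (\<lambda>v. Poly_Mapping.single (mono1 v) (lin p v))"
  define z where "z = C X1 + C X2 - C Y1 - C Y2"
  define z' where "z' = C X3 + C X4 - C Y3 - C Y4"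
  have "vanishing_jet (z * p)" "vanishing_jet (z' * p)"
    by (rule vanishing_jetI[where c = 0];
        (elim surviving_pairs_cases)?; simp add: z_def z'_def C_def p quad_mult)+
  moreover have "lin z v * lin z' v = 0" for v by (cases v) (simp_all add: z_def z'_def C_def)
  ultimately consider "\<forall>v. lin z v = 0" | "\<forall>v. lin z' v = 0" using disjoint by blast
  then show False
  proof cases
    case 1
    then have 0: "lin p X1 = 0" "lin p X2 = 0" "lin p Y1 = 0" "lin p Y2 = 0"
      using spec[OF 1, of X1] spec[OF 1, of X2] spec[OF 1, of Y1] spec[OF 1, of Y2]
      by (simp_all add: z_def C_def)
    have "vanishing_jet (pvar X1 * p)" "vanishing_jet (pvar X2 * p)"
      by (rule vanishing_jetI[where c = 0]; (elim surviving_pairs_cases)?; simp add: p 0 quad_mult)+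
    then have "(\<forall>v. lin (pvar X1 :: 'k mpoly8) v = 0) \<or> (\<forall>v. lin (pvar X2 :: 'k mpoly8) v = 0)"
      by (rule disjoint) simp
    then show False by (metis lin_pvar_self zero_neq_one)
  next
    case 2
    then have 0: "lin p X3 = 0" "lin p X4 = 0" "lin p Y3 = 0" "lin p Y4 = 0"
      using spec[OF 2, of X3] spec[OF 2, of X4] spec[OF 2, of Y3] spec[OF 2, of Y4]
      by (simp_all add: z'_def C_def)
    have "vanishing_jet (pvar X3 * p)" "vanishing_jet (pvar X4 * p)"
      by (rule vanishing_jetI[where c = 0]; (elim surviving_pairs_cases)?; simp add: p 0 quad_mult)+
    then have "(\<forall>v. lin (pvar X3 :: 'k mpoly8) v = 0) \<or> (\<forall>v. lin (pvar X4 :: 'k mpoly8) v = 0)"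
      by (rule disjoint) simp
    then show False by (metis lin_pvar_self zero_neq_one)
  qed
qed

lemma no_exact_zero_divisors: "\<not> has_exact_zero_divisors (ring_R :: 'k::field mpoly8 set ring)"
proof
  assume "has_exact_zero_divisors (ring_R :: 'k mpoly8 set ring)"
  then obtain a b where ab: "exact_zero_divisor_pair (ring_R :: 'k mpoly8 set ring) a b"
    by (auto simp: has_exact_zero_divisors_def)
  then obtain p q where pq: "a = cls p" "b = cls q"
    by (auto simp: exact_zero_divisor_pair_def carrier_ring_R)
  with ab have "cst p = 0" "cst q = 0" using cls_unit by (auto simp: exact_zero_divisor_pair_def)
  from not_exact_zero_divisor[OF this] ab pq show False by (simp add: exact_zero_divisor_pair_def)
qed

section \<open>Kernels of two linear matrices\<close>

text \<open>The four linear forms from which the two matrices are built. Within each block, \<open>sx\<close> and \<open>ux\<close> restrict to a basis of the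
\<open>X\<close>-forms, and likewise for the \<open>Y\<close>-forms; the product \<open>sx * sy\<close> is the relation among the surviving monomials.\<close>

abbreviation "sx \<equiv> pvar X1 + pvar X2 + pvar X3 + pvar X4"
abbreviation "sy \<equiv> pvar Y1 + pvar Y2 + pvar Y3 + pvar Y4"
abbreviation "ux \<equiv> pvar X1 + pvar X3"
abbreviation "uy \<equiv> pvar Y1 + pvar Y3"

definition lin_poly :: "(var \<Rightarrow> 'k::field) \<Rightarrow> 'k mpoly8" where
  "lin_poly h = Poly_Mapping.single (mono1 X1) (h X1) + Poly_Mapping.single (mono1 X2) (h X2)
     + Poly_Mapping.single (mono1 X3) (h X3) + Poly_Mapping.single (mono1 X4) (h X4)
     + Poly_Mapping.single (mono1 Y1) (h Y1) + Poly_Mapping.single (mono1 Y2) (h Y2)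
     + Poly_Mapping.single (mono1 Y3) (h Y3) + Poly_Mapping.single (mono1 Y4) (h Y4)"

lemma lin_poly_jet [simp]: "cst (lin_poly h) = 0" "lin (lin_poly h) v = h v" "quad (lin_poly h) v w = 0"
  by (simp_all add: lin_poly_def) (cases v; simp)

text \<open>The conditions on the linear coefficients of \<open>f\<close> and \<open>g\<close> in one block for the matrix
with rows \<open>(sx + sy, ux + e uy)\<close> and \<open>(e uy - ux, sx)\<close> to map \<open>(f, g)\<close> to \<open>l\<close> and \<open>m\<close> times the sum of the surviving monomials.
Here \<open>fX1\<close> is the coefficient of the first \<open>X\<close> of the block in \<open>f\<close>, and so on. The unique solution is the
value of the adjugate at the constant vector \<open>(l, m)\<close>. The same system arises in both blocks.\<close>

lemma linear_solutions:
  fixes e l m :: "'k::field"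
  assumes e: "e * e = 1"
    and "fY1 + fX1 + gY1 + e * gX1 = l" "fY2 + fX1 + gY2 = l" "fY1 + fX2 + e * gX2 = l" "fY2 + fX2 = l"
    and "e * fX1 - fY1 + gY1 = m" "- fY2 + gY2 = m" "e * fX2 + gY1 = m" "gY2 = m"
  shows "fX1 = l - m" "fX2 = l" "fY1 = - e * m" "fY2 = 0"
    "gX1 = l + m" "gX2 = m" "gY1 = m - e * l" "gY2 = m"
proof -
  have cancel: "e * a = e * b \<Longrightarrow> a = b" for a b
    using e by (metis mult.assoc mult_1)
  show gY2: "gY2 = m" and fY2: "fY2 = 0" using assms by simp_all
  show fX2: "fX2 = l" using assms fY2 by simp
  show fX1: "fX1 = l - m" using assms fY2 gY2 by (simp add: algebra_simps)
  show gY1: "gY1 = m - e * l" using assms fX2 by (simp add: algebra_simps)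
  have "e * (l - m) - fY1 + (m - e * l) = m" using assms fX1 gY1 by simp
  then show fY1: "fY1 = - e * m" by (simp add: algebra_simps eq_neg_iff_add_eq_0)
  show "gX2 = m" using assms(4) fX2 fY1 by - (rule cancel, simp add: algebra_simps)
  show "gX1 = l + m" using assms(2) fX1 fY1 gY1 by - (rule cancel, simp add: algebra_simps)
qed

text \<open>The linear coefficients of the first product at \<open>X2\<close> and \<open>X1\<close> show that \<open>f\<close> and \<open>g\<close> have no constant
term; the quadratic coefficients then give the system \<open>linear_solutions\<close> in each block, with
the same \<open>l\<close> and \<open>m\<close>.\<close>

lemma linear_part_in_image:
  fixes e :: "'k::field" and f g :: "'k mpoly8"
  defines "Y \<equiv> Poly_Mapping.single 0 e * uy"
  assumes e: "e * e = 1"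
    and K1: "vanishing_jet ((sx + sy) * f + (ux + Y) * g)"
    and K2: "vanishing_jet ((Y - ux) * f + sx * g)"
  obtains l m where "cst f = 0" "cst g = 0"
    "\<And>v. lin f v = lin (sx * Poly_Mapping.single 0 l - (ux + Y) * Poly_Mapping.single 0 m) v"
    "\<And>v. lin g v = lin ((ux - Y) * Poly_Mapping.single 0 l + (sx + sy) * Poly_Mapping.single 0 m) v"
proof -
  from K1 have lin1: "lin ((sx + sy) * f + (ux + Y) * g) v = 0" for v by (simp only: vanishing_jet_def)
  have f0: "cst f = 0" using lin1[of X2] by (simp add: Y_def)
  have g0: "cst g = 0" using lin1[of X1] f0 by (simp add: Y_def)
  obtain l where l: "\<And>v w. (v, w) \<in> surviving_pairs \<Longrightarrow> quad ((sx + sy) * f + (ux + Y) * g) v w = l"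
    using vanishing_jet_quad[OF K1] by blast
  obtain m where m: "\<And>v w. (v, w) \<in> surviving_pairs \<Longrightarrow> quad ((Y - ux) * f + sx * g) v w = m"
    using vanishing_jet_quad[OF K2] by blast
  note jet = Y_def f0 g0 quad_mult surviving_pairs_def
  note S1 = linear_solutions[OF e, of "lin f Y1" "lin f X1" "lin g Y1" "lin g X1" l "lin f Y2" "lin g Y2" "lin f X2" "lin g X2" m]
  note S2 = linear_solutions[OF e, of "lin f Y3" "lin f X3" "lin g Y3" "lin g X3" l "lin f Y4" "lin g Y4" "lin f X4" "lin g X4" m]
  have B1: "lin f X1 = l - m" "lin f X2 = l" "lin f Y1 = - e * m" "lin f Y2 = 0"
    "lin g X1 = l + m" "lin g X2 = m" "lin g Y1 = m - e * l" "lin g Y2 = m"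
    by (rule S1; use l[of X1 Y1] l[of X1 Y2] l[of X2 Y1] l[of X2 Y2]
        m[of X1 Y1] m[of X1 Y2] m[of X2 Y1] m[of X2 Y2] in \<open>simp add: jet algebra_simps\<close>)+
  have B2: "lin f X3 = l - m" "lin f X4 = l" "lin f Y3 = - e * m" "lin f Y4 = 0"
    "lin g X3 = l + m" "lin g X4 = m" "lin g Y3 = m - e * l" "lin g Y4 = m"
    by (rule S2; use l[of X3 Y3] l[of X3 Y4] l[of X4 Y3] l[of X4 Y4]
        m[of X3 Y3] m[of X3 Y4] m[of X4 Y3] m[of X4 Y4] in \<open>simp add: jet algebra_simps\<close>)+
  show thesis
  proof (rule that[of l m, OF f0 g0])
    show "lin f v = lin (sx * Poly_Mapping.single 0 l - (ux + Y) * Poly_Mapping.single 0 m) v" for v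
      by (cases v) (simp_all add: B1 B2 Y_def)
    show "lin g v = lin ((ux - Y) * Poly_Mapping.single 0 l + (sx + sy) * Poly_Mapping.single 0 m) v" for v
      by (cases v) (simp_all add: B1 B2 Y_def algebra_simps)
  qed
qed

text \<open>The adjugate maps pairs of linear forms onto all pairs of quadratic forms. Each block
contributes eight equations in eight unknowns, which can be solved one after the other.\<close>

lemma quadratic_part_in_image:
  fixes e :: "'k::field" and a b :: "var \<Rightarrow> var \<Rightarrow> 'k"
  defines "Y \<equiv> Poly_Mapping.single 0 e * uy"
  assumes e: "e * e = 1"
  obtains c d where "cst c = 0" "cst d = 0"
    "\<And>v w. (v, w) \<in> surviving_pairs \<Longrightarrow> quad (sx * c - (ux + Y) * d) v w = a v w"
    "\<And>v w. (v, w) \<in> surviving_pairs \<Longrightarrow> quad ((ux - Y) * c + (sx + sy) * d) v w = b v w"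
proof -
  \<comment> \<open>back substitution in the block \<open>x1, x2, y1, y2\<close>: the equation at \<open>x2 y2\<close> comes first because neither \<open>ux\<close> nor \<open>uy\<close>
    involves \<open>x2\<close> or \<open>y2\<close>\<close>
  define solve where "solve = (\<lambda>x1 x2 y1 y2. let
      cY2 = a x2 y2; dY2 = cY2 - a x1 y2; dX2 = b x2 y2 - dY2; cY1 = a x2 y1 + e * dX2;
      dX1 = b x1 y2 - cY2 - dY2; dY1 = cY1 - e * dX1 - a x1 y1;
      cX2 = e * (dY1 + dX2 - b x2 y1); cX1 = e * (cY1 + dY1 + dX1 - b x1 y1)
    in ((cX1, cX2, cY1, cY2), (dX1, dX2, dY1, dY2)))"
  have ee: "e * (e * t) = t" for t using e by (simp add: mult.assoc[symmetric])
  obtain cX1 cX2 cY1 cY2 dX1 dX2 dY1 dY2 where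
    s1: "solve X1 X2 Y1 Y2 = ((cX1, cX2, cY1, cY2), (dX1, dX2, dY1, dY2))" by (metis prod_cases4 surj_pair)
  obtain cX3 cX4 cY3 cY4 dX3 dX4 dY3 dY4 where
    s2: "solve X3 X4 Y3 Y4 = ((cX3, cX4, cY3, cY4), (dX3, dX4, dY3, dY4))" by (metis prod_cases4 surj_pair)
  define c where "c = lin_poly (case_var cX1 cX2 cX3 cX4 cY1 cY2 cY3 cY4)"
  define d where "d = lin_poly (case_var dX1 dX2 dX3 dX4 dY1 dY2 dY3 dY4)"
  have 1: "cY2 = a X2 Y2" "dY2 = cY2 - a X1 Y2" "dX2 = b X2 Y2 - dY2" "cY1 = a X2 Y1 + e * dX2"
      "dX1 = b X1 Y2 - cY2 - dY2" "dY1 = cY1 - e * dX1 - a X1 Y1"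
      "cX2 = e * (dY1 + dX2 - b X2 Y1)" "cX1 = e * (cY1 + dY1 + dX1 - b X1 Y1)"
    using s1 by (auto simp: solve_def Let_def)
  have 2: "cY4 = a X4 Y4" "dY4 = cY4 - a X3 Y4" "dX4 = b X4 Y4 - dY4" "cY3 = a X4 Y3 + e * dX4"
      "dX3 = b X3 Y4 - cY4 - dY4" "dY3 = cY3 - e * dX3 - a X3 Y3"
      "cX4 = e * (dY3 + dX4 - b X4 Y3)" "cX3 = e * (cY3 + dY3 + dX3 - b X3 Y3)"
    using s2 by (auto simp: solve_def Let_def)
  show thesis
  proof (rule that[of c d])
    show "quad (sx * c - (ux + Y) * d) v w = a v w" if "(v, w) \<in> surviving_pairs" for v w
      using that by (cases rule: surviving_pairs_cases)
        (simp_all add: quad_mult c_def d_def Y_def 1 2 ee algebra_simps)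
    show "quad ((ux - Y) * c + (sx + sy) * d) v w = b v w" if "(v, w) \<in> surviving_pairs" for v w
      using that by (cases rule: surviving_pairs_cases)
        (simp_all add: quad_mult c_def d_def Y_def 1 2 ee algebra_simps)
  qed (simp_all add: c_def d_def)
qed

text \<open>The linear part of a kernel element comes from a constant vector and its quadratic part from a
pair of linear forms; there is nothing in higher degree. The sign \<open>e\<close> makes one statement serve both matrices: exchanging
the two rows and the two columns of the adjugate turns it into the original matrix with \<open>uy\<close> replaced by \<open>- uy\<close>.\<close>

lemma kernel_in_image:
  fixes e :: "'k::field" and f g :: "'k mpoly8"
  defines "Y \<equiv> Poly_Mapping.single 0 e * uy"
  assumes e: "e * e = 1"
    and K1: "vanishing_jet ((sx + sy) * f + (ux + Y) * g)"
    and K2: "vanishing_jet ((Y - ux) * f + sx * g)"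
  obtains c d where "vanishing_jet (f - (sx * c - (ux + Y) * d))"
    "vanishing_jet (g - ((ux - Y) * c + (sx + sy) * d))"
proof -
  obtain l m where f0: "cst f = 0" and g0: "cst g = 0"
    and lf: "\<And>v. lin f v = lin (sx * Poly_Mapping.single 0 l - (ux + Y) * Poly_Mapping.single 0 m) v"
    and lg: "\<And>v. lin g v = lin ((ux - Y) * Poly_Mapping.single 0 l + (sx + sy) * Poly_Mapping.single 0 m) v"
    using linear_part_in_image[OF e K1[unfolded Y_def] K2[unfolded Y_def]] unfolding Y_def by metis
  obtain c d where c0: "cst c = 0" and d0: "cst d = 0"
    and qf: "\<And>v w. (v, w) \<in> surviving_pairs \<Longrightarrow> quad (sx * c - (ux + Y) * d) v w = quad f v w"
    and qg: "\<And>v w. (v, w) \<in> surviving_pairs \<Longrightarrow> quad ((ux - Y) * c + (sx + sy) * d) v w = quad g v w"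
    using quadratic_part_in_image[OF e, of "quad f" "quad g"] unfolding Y_def by metis
  let ?l = "Poly_Mapping.single 0 l" and ?m = "Poly_Mapping.single 0 m"
  have Y: "cst Y = 0" "v \<noteq> w \<Longrightarrow> quad Y v w = 0" for v w by (simp_all add: Y_def quad_mult)
  show thesis
  proof (rule that[of "?l + c" "?m + d"]; rule vanishing_jetI[where c = 0])
    fix v w assume vw: "(v, w) \<in> surviving_pairs"
    note ne = surviving_pairs_neq[OF vw]
    show "quad (f - (sx * (?l + c) - (ux + Y) * (?m + d))) v w = 0"
      using qf[OF vw] by (simp add: quad_mult[OF ne] Y(1) Y(2)[OF ne] c0 d0 algebra_simps)
    show "quad (g - ((ux - Y) * (?l + c) + (sx + sy) * (?m + d))) v w = 0"
      using qg[OF vw] by (simp add: quad_mult[OF ne] Y(1) Y(2)[OF ne] c0 d0 algebra_simps)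
  next
    fix v
    show "lin (f - (sx * (?l + c) - (ux + Y) * (?m + d))) v = 0"
      using lf[of v] by (simp add: Y(1) c0 d0)
    show "lin (g - ((ux - Y) * (?l + c) + (sx + sy) * (?m + d))) v = 0"
      using lg[of v] by (simp add: Y(1) c0 d0)
  qed (simp_all add: f0 g0 Y(1))
qed

section \<open>Modules over a commutative ring\<close>

text \<open>The locale fixes the record type of \<open>M\<close> without extension fields, the type to which
freeness and finite generation refer.\<close>

locale plain_module = module R M
  for R :: "('a, 'm) ring_scheme" (structure) and M :: "('a, 'b) module" (structure)
begin

text \<open>The generators may coincide, as can happen for images of distinct generators in a quotient; the sum over \<open>{u, v}\<close>
then has a single term.\<close>

lemma finitely_generated_two:
  assumes uv: "u \<in> carrier M" "v \<in> carrier M"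
    and span: "\<And>x. x \<in> carrier M \<Longrightarrow> \<exists>a\<in>carrier R. \<exists>b\<in>carrier R. x = a \<odot>\<^bsub>M\<^esub> u \<oplus>\<^bsub>M\<^esub> b \<odot>\<^bsub>M\<^esub> v"
  shows "finitely_generated_module R M"
  unfolding finitely_generated_module_def
proof (intro conjI exI[of _ "{u, v}"] ballI)
  fix x assume "x \<in> carrier M"
  then obtain a b where ab: "a \<in> carrier R" "b \<in> carrier R" and x: "x = a \<odot>\<^bsub>M\<^esub> u \<oplus>\<^bsub>M\<^esub> b \<odot>\<^bsub>M\<^esub> v"
    using span by blast
  show "\<exists>c\<in>{u, v} \<rightarrow> carrier R. x = (\<Oplus>\<^bsub>M\<^esub>s\<in>{u, v}. c s \<odot>\<^bsub>M\<^esub> s)"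
  proof (cases "u = v")
    case True
    then show ?thesis using ab uv
      by (intro bexI[of _ "\<lambda>_. a \<oplus>\<^bsub>R\<^esub> b"]) (auto simp: x smult_l_distr M.finsum_insert)
  next
    case False
    then show ?thesis using ab uv
      by (intro bexI[of _ "\<lambda>s. if s = u then a else b"]) (auto simp: x M.finsum_insert Pi_def)
  qed
qed (use module_axioms uv in auto)

text \<open>If \<open>z\<close> annihilates \<open>M\<close> and \<open>b\<close> is a basis element, then \<open>z b = 0 = 0 b\<close> are two
expansions of zero.\<close>

lemma not_free_if_annihilated:
  assumes z: "z \<in> carrier R" "z \<noteq> \<zero>\<^bsub>R\<^esub>" "\<And>x. x \<in> carrier M \<Longrightarrow> z \<odot>\<^bsub>M\<^esub> x = \<zero>\<^bsub>M\<^esub>"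
    and x: "x \<in> carrier M" "x \<noteq> \<zero>\<^bsub>M\<^esub>"
  shows "\<not> free_module R M"
proof
  assume "free_module R M"
  then obtain B where B: "module_basis R M B" by (auto simp: free_module_def)
  let ?sum = "\<lambda>c. \<Oplus>\<^bsub>M\<^esub>b\<in>{b \<in> B. c b \<noteq> \<zero>\<^bsub>R\<^esub>}. c b \<odot>\<^bsub>M\<^esub> b"
  have BM: "B \<subseteq> carrier M" and unique: "\<And>y. y \<in> carrier M \<Longrightarrow> \<exists>!c. c \<in> coefficient_families R B \<and> y = ?sum c"
    using B by (auto simp: module_basis_def)
  obtain b where b: "b \<in> B"
  proof (cases "B = {}")
    case True
    obtain c where "x = ?sum c" using unique[OF x(1)] by blast
    with True x(2) show ?thesis by simp
  qed blast
  define c0 where "c0 = (\<lambda>b'\<in>B. \<zero>\<^bsub>R\<^esub>)"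
  define c1 where "c1 = (\<lambda>b'\<in>B. if b' = b then z else \<zero>\<^bsub>R\<^esub>)"
  have s0: "{b' \<in> B. c0 b' \<noteq> \<zero>\<^bsub>R\<^esub>} = {}" and s1: "{b' \<in> B. c1 b' \<noteq> \<zero>\<^bsub>R\<^esub>} = {b}"
    using b z(2) by (auto simp: c0_def c1_def)
  have "c0 \<in> coefficient_families R B" "c1 \<in> coefficient_families R B"
    unfolding coefficient_families_def mem_Collect_eq s0 s1 using z(1) by (auto simp: c0_def c1_def)
  moreover have "\<zero>\<^bsub>M\<^esub> = ?sum c0" unfolding s0 by simp
  moreover have "\<zero>\<^bsub>M\<^esub> = ?sum c1" unfolding s1 using b BM z by (auto simp: c1_def M.finsum_insert)
  ultimately have "c0 = c1" using unique[OF M.zero_closed] by blast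
  from fun_cong[OF this, of b] show False using b z(2) by (simp add: c0_def c1_def)
qed

context
  fixes N
  assumes N: "subgroup N (add_monoid M)" and N_smult: "\<forall>a\<in>carrier R. \<forall>x\<in>N. a \<odot>\<^bsub>M\<^esub> x \<in> N"
begin

lemma abelian_subgroup_N: "abelian_subgroup N M"
  by (rule abelian_subgroupI3) (use N in \<open>auto intro: additive_subgroup.intro M.abelian_group_axioms\<close>)

lemma carrier_quotient_module: "carrier (quotient_module M N) = {N +>\<^bsub>M\<^esub> x | x. x \<in> carrier M}"
  by (auto simp: quotient_module_def A_RCOSETS_def')

lemma quotient_module_zero: "\<zero>\<^bsub>quotient_module M N\<^esub> = N"
  by (simp add: quotient_module_def)

lemma quotient_module_add:
  "x \<in> carrier M \<Longrightarrow> y \<in> carrier M \<Longrightarrow>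
    (N +>\<^bsub>M\<^esub> x) \<oplus>\<^bsub>quotient_module M N\<^esub> (N +>\<^bsub>M\<^esub> y) = N +>\<^bsub>M\<^esub> (x \<oplus>\<^bsub>M\<^esub> y)"
  using abelian_subgroup.a_rcos_sum[OF abelian_subgroup_N] by (simp add: quotient_module_def)

lemma coset_eq_self_iff: "x \<in> carrier M \<Longrightarrow> N +>\<^bsub>M\<^esub> x = N \<longleftrightarrow> x \<in> N"
  using abelian_subgroup.a_rcos_const[OF abelian_subgroup_N, of x]
    abelian_subgroup.a_rcos_self[OF abelian_subgroup_N, of x] by auto

lemma quotient_module_smult:
  assumes a: "a \<in> carrier R" and x: "x \<in> carrier M"
  shows "a \<odot>\<^bsub>quotient_module M N\<^esub> (N +>\<^bsub>M\<^esub> x) = N +>\<^bsub>M\<^esub> (a \<odot>\<^bsub>M\<^esub> x)"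
proof -
  have NM: "N \<subseteq> carrier M" using subgroup.subset[OF N] by simp
  have *: "N +>\<^bsub>M\<^esub> (a \<odot>\<^bsub>M\<^esub> y) = N +>\<^bsub>M\<^esub> (a \<odot>\<^bsub>M\<^esub> x)" if y: "y \<in> N +>\<^bsub>M\<^esub> x" for y
  proof -
    from y obtain n where n: "n \<in> N" "y = n \<oplus>\<^bsub>M\<^esub> x" by (auto simp: a_r_coset_def')
    have "N +>\<^bsub>M\<^esub> (a \<odot>\<^bsub>M\<^esub> y) = N +>\<^bsub>M\<^esub> (a \<odot>\<^bsub>M\<^esub> n \<oplus>\<^bsub>M\<^esub> a \<odot>\<^bsub>M\<^esub> x)"
      using n NM a x by (simp add: smult_r_distr subsetD)
    also have "\<dots> = (N +>\<^bsub>M\<^esub> (a \<odot>\<^bsub>M\<^esub> n)) +>\<^bsub>M\<^esub> (a \<odot>\<^bsub>M\<^esub> x)"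
      by (rule M.a_coset_add_assoc[OF NM, symmetric]) (use n NM a x in blast)+
    also have "N +>\<^bsub>M\<^esub> (a \<odot>\<^bsub>M\<^esub> n) = N"
      using N_smult a n(1) NM by (simp add: coset_eq_self_iff subsetD)
    finally show ?thesis .
  qed
  have "x \<in> N +>\<^bsub>M\<^esub> x" by (rule abelian_subgroup.a_rcos_self[OF abelian_subgroup_N x])
  then have ne: "N +>\<^bsub>M\<^esub> x \<noteq> {}" by blast
  have "a \<odot>\<^bsub>quotient_module M N\<^esub> (N +>\<^bsub>M\<^esub> x) = (\<Union>y\<in>N +>\<^bsub>M\<^esub> x. N +>\<^bsub>M\<^esub> (a \<odot>\<^bsub>M\<^esub> y))"
    by (simp add: quotient_module_def)
  also have "\<dots> = (\<Union>y\<in>N +>\<^bsub>M\<^esub> x. N +>\<^bsub>M\<^esub> (a \<odot>\<^bsub>M\<^esub> x))"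
    by (rule SUP_cong[OF refl *])
  finally show ?thesis by (simp only: UN_constant ne if_False)
qed

lemma quotient_module_module: "module R (quotient_module M N)"
proof (rule moduleI[OF R.cring_axioms])
  have NM: "N \<subseteq> carrier M" using subgroup.subset[OF N] by simp
  have N0: "N = N +>\<^bsub>M\<^esub> \<zero>\<^bsub>M\<^esub>" using M.a_coset_add_zero[OF NM] by simp
  show "abelian_group (quotient_module M N)"
  proof (rule abelian_groupI)
    show "\<zero>\<^bsub>quotient_module M N\<^esub> \<in> carrier (quotient_module M N)"
      using N0 M.zero_closed unfolding carrier_quotient_module quotient_module_zero by blast
    fix C assume "C \<in> carrier (quotient_module M N)"
    then obtain x where x: "C = N +>\<^bsub>M\<^esub> x" "x \<in> carrier M" by (auto simp: carrier_quotient_module)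
    have "(N +>\<^bsub>M\<^esub> \<zero>\<^bsub>M\<^esub>) \<oplus>\<^bsub>quotient_module M N\<^esub> C = C"
      unfolding x(1) by (subst quotient_module_add) (simp_all add: x(2))
    then show "\<zero>\<^bsub>quotient_module M N\<^esub> \<oplus>\<^bsub>quotient_module M N\<^esub> C = C"
      using N0 by (simp add: quotient_module_zero)
    have "(N +>\<^bsub>M\<^esub> (\<ominus>\<^bsub>M\<^esub> x)) \<oplus>\<^bsub>quotient_module M N\<^esub> C = \<zero>\<^bsub>quotient_module M N\<^esub>"
      unfolding x(1) by (subst quotient_module_add) (simp_all add: x(2) M.l_neg quotient_module_zero N0[symmetric])
    moreover have "N +>\<^bsub>M\<^esub> (\<ominus>\<^bsub>M\<^esub> x) \<in> carrier (quotient_module M N)"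
      using x(2) unfolding carrier_quotient_module by blast
    ultimately show "\<exists>D\<in>carrier (quotient_module M N). D \<oplus>\<^bsub>quotient_module M N\<^esub> C = \<zero>\<^bsub>quotient_module M N\<^esub>"
      by blast
  qed (auto simp: carrier_quotient_module quotient_module_add M.a_ac)
qed (auto simp: carrier_quotient_module quotient_module_add quotient_module_smult
      smult_l_distr smult_r_distr smult_assoc1)

end

end

lemma (in plain_module) module_isomorphic_self: "module_isomorphic R M M"
  unfolding module_isomorphic_def
  by (intro bexI[of _ "\<lambda>x\<in>carrier M. x"]) (auto simp: module_homs_def bij_betw_def inj_on_def)

section \<open>The free module of rank two and its dual\<close>

lemma regular_module_simps [simp]:
  "carrier (regular_module A) = carrier A" "\<zero>\<^bsub>regular_module A\<^esub> = \<zero>\<^bsub>A\<^esub>"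
  "x \<oplus>\<^bsub>regular_module A\<^esub> y = x \<oplus>\<^bsub>A\<^esub> y" "a \<odot>\<^bsub>regular_module A\<^esub> x = a \<otimes>\<^bsub>A\<^esub> x"
  by (simp_all add: regular_module_def)

text \<open>A totally extended pair, constant from index one on, so that equality of pairs is equality of functions and no
restriction of the domain has to be carried along.\<close>

definition pair :: "'a \<Rightarrow> 'a \<Rightarrow> nat \<Rightarrow> 'a" where
  "pair a b = (\<lambda>i. if i = 0 then a else b)"

lemma pair_simps [simp]: "pair a b 0 = a" "pair a b (Suc 0) = b"
  by (simp_all add: pair_def)

lemma pair_eq_iff [simp]: "pair a b = pair c d \<longleftrightarrow> a = c \<and> b = d"
  by (metis pair_simps)

definition free2 :: "('a, 'm) ring_scheme \<Rightarrow> ('a, nat \<Rightarrow> 'a) module" where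
  "free2 A = \<lparr>carrier = {pair a b | a b. a \<in> carrier A \<and> b \<in> carrier A},
     monoid.mult = undefined, one = undefined, zero = pair \<zero>\<^bsub>A\<^esub> \<zero>\<^bsub>A\<^esub>,
     add = (\<lambda>f g. pair (f 0 \<oplus>\<^bsub>A\<^esub> g 0) (f 1 \<oplus>\<^bsub>A\<^esub> g 1)),
     module.smult = (\<lambda>a f. pair (a \<otimes>\<^bsub>A\<^esub> f 0) (a \<otimes>\<^bsub>A\<^esub> f 1))\<rparr>"

definition mat_map :: "('a, 'm) ring_scheme \<Rightarrow> 'a \<Rightarrow> 'a \<Rightarrow> 'a \<Rightarrow> 'a \<Rightarrow> (nat \<Rightarrow> 'a) \<Rightarrow> nat \<Rightarrow> 'a" where
  "mat_map A p q r w = (\<lambda>f\<in>carrier (free2 A).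
     pair (p \<otimes>\<^bsub>A\<^esub> f 0 \<oplus>\<^bsub>A\<^esub> q \<otimes>\<^bsub>A\<^esub> f 1) (r \<otimes>\<^bsub>A\<^esub> f 0 \<oplus>\<^bsub>A\<^esub> w \<otimes>\<^bsub>A\<^esub> f 1))"

definition row_map :: "('a, 'm) ring_scheme \<Rightarrow> 'a \<Rightarrow> 'a \<Rightarrow> (nat \<Rightarrow> 'a) \<Rightarrow> 'a" where
  "row_map A g h = (\<lambda>f\<in>carrier (free2 A). g \<otimes>\<^bsub>A\<^esub> f 0 \<oplus>\<^bsub>A\<^esub> h \<otimes>\<^bsub>A\<^esub> f 1)"

lemma free2_simps [simp]:
  "f \<in> carrier (free2 A) \<longleftrightarrow> (\<exists>a\<in>carrier A. \<exists>b\<in>carrier A. f = pair a b)"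
  "\<zero>\<^bsub>free2 A\<^esub> = pair \<zero>\<^bsub>A\<^esub> \<zero>\<^bsub>A\<^esub>"
  "pair a b \<oplus>\<^bsub>free2 A\<^esub> pair c d = pair (a \<oplus>\<^bsub>A\<^esub> c) (b \<oplus>\<^bsub>A\<^esub> d)"
  "x \<odot>\<^bsub>free2 A\<^esub> pair a b = pair (x \<otimes>\<^bsub>A\<^esub> a) (x \<otimes>\<^bsub>A\<^esub> b)"
  by (auto simp: free2_def)

context cring
begin

lemma free2_module: "module R (free2 R)"
proof (rule moduleI[OF cring_axioms])
  show "abelian_group (free2 R)"
  proof (rule abelian_groupI)
    fix x assume "x \<in> carrier (free2 R)"
    then obtain a b where "x = pair a b" "a \<in> carrier R" "b \<in> carrier R" by auto
    then show "\<exists>y\<in>carrier (free2 R). y \<oplus>\<^bsub>free2 R\<^esub> x = \<zero>\<^bsub>free2 R\<^esub>"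
      by (intro bexI[of _ "pair (\<ominus> a) (\<ominus> b)"]) (auto simp: l_neg)
  qed (auto simp: a_ac)
qed (auto simp: l_distr r_distr m_assoc)

lemma mat_map_pair [simp]:
  "a \<in> carrier R \<Longrightarrow> b \<in> carrier R \<Longrightarrow>
    mat_map R p q r w (pair a b) = pair (p \<otimes> a \<oplus> q \<otimes> b) (r \<otimes> a \<oplus> w \<otimes> b)"
  by (simp add: mat_map_def)

lemma row_map_pair [simp]:
  "a \<in> carrier R \<Longrightarrow> b \<in> carrier R \<Longrightarrow> row_map R g h (pair a b) = g \<otimes> a \<oplus> h \<otimes> b"
  by (simp add: row_map_def)

lemma lincomb_add:
  assumes "g \<in> carrier R" "h \<in> carrier R" "a \<in> carrier R" "b \<in> carrier R" "c \<in> carrier R" "d \<in> carrier R"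
  shows "g \<otimes> (a \<oplus> c) \<oplus> h \<otimes> (b \<oplus> d) = (g \<otimes> a \<oplus> h \<otimes> b) \<oplus> (g \<otimes> c \<oplus> h \<otimes> d)"
  using assms by (simp add: r_distr a_ac)

lemma lincomb_smult:
  assumes "g \<in> carrier R" "h \<in> carrier R" "a \<in> carrier R" "b \<in> carrier R" "x \<in> carrier R"
  shows "g \<otimes> (x \<otimes> a) \<oplus> h \<otimes> (x \<otimes> b) = x \<otimes> (g \<otimes> a \<oplus> h \<otimes> b)"
  using assms by (simp add: r_distr m_lcomm)

lemma mat_map_hom:
  assumes "p \<in> carrier R" "q \<in> carrier R" "r \<in> carrier R" "w \<in> carrier R"
  shows "mat_map R p q r w \<in> module_homs R (free2 R) (free2 R)"
  unfolding module_homs_def using assms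
  by (auto simp: lincomb_add lincomb_smult) (auto simp: mat_map_def)

lemma row_map_hom:
  assumes "g \<in> carrier R" "h \<in> carrier R"
  shows "row_map R g h \<in> module_homs R (free2 R) (regular_module R)"
  unfolding module_homs_def using assms
  by (auto simp: lincomb_add lincomb_smult) (auto simp: row_map_def)

text \<open>A functional is determined by its values at the two unit vectors, so the dual of the free module of rank two consists of
row vectors.\<close>

lemma free2_dual_cases:
  assumes "\<phi> \<in> module_homs R (free2 R) (regular_module R)"
  obtains g h where "g \<in> carrier R" "h \<in> carrier R" "\<phi> = row_map R g h"
proof -
  let ?g = "\<phi> (pair \<one> \<zero>)" and ?h = "\<phi> (pair \<zero> \<one>)"
  have \<phi>: "\<phi> \<in> carrier (free2 R) \<rightarrow>\<^sub>E carrier R"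
    "\<And>x y. x \<in> carrier (free2 R) \<Longrightarrow> y \<in> carrier (free2 R) \<Longrightarrow> \<phi> (x \<oplus>\<^bsub>free2 R\<^esub> y) = \<phi> x \<oplus> \<phi> y"
    "\<And>a x. a \<in> carrier R \<Longrightarrow> x \<in> carrier (free2 R) \<Longrightarrow> \<phi> (a \<odot>\<^bsub>free2 R\<^esub> x) = a \<otimes> \<phi> x"
    using assms by (auto simp: module_homs_def)
  have g: "?g \<in> carrier R" and h: "?h \<in> carrier R" using \<phi>(1) by (auto intro!: PiE_mem[OF \<phi>(1)])
  have "\<phi> f = row_map R ?g ?h f" for f
  proof (cases "f \<in> carrier (free2 R)")
    case True
    then obtain a b where ab: "a \<in> carrier R" "b \<in> carrier R" and f: "f = pair a b" by auto
    have "f = a \<odot>\<^bsub>free2 R\<^esub> pair \<one> \<zero> \<oplus>\<^bsub>free2 R\<^esub> b \<odot>\<^bsub>free2 R\<^esub> pair \<zero> \<one>" using ab by (simp add: f)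
    then have "\<phi> f = \<phi> (a \<odot>\<^bsub>free2 R\<^esub> pair \<one> \<zero>) \<oplus> \<phi> (b \<odot>\<^bsub>free2 R\<^esub> pair \<zero> \<one>)"
      using ab by (simp only:) (intro \<phi>(2), auto)
    also have "\<phi> (a \<odot>\<^bsub>free2 R\<^esub> pair \<one> \<zero>) = a \<otimes> ?g" using ab by (intro \<phi>(3)) auto
    also have "\<phi> (b \<odot>\<^bsub>free2 R\<^esub> pair \<zero> \<one>) = b \<otimes> ?h" using ab by (intro \<phi>(3)) auto
    finally show ?thesis using ab g h by (simp add: f m_comm)
  next
    case False
    then show ?thesis using PiE_arb[OF \<phi>(1) False] by (simp add: row_map_def)
  qed
  then show thesis using g h that by blast
qed

lemma row_map_eq_iff:
  assumes "g \<in> carrier R" "h \<in> carrier R" "g' \<in> carrier R" "h' \<in> carrier R"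
  shows "row_map R g h = row_map R g' h' \<longleftrightarrow> g = g' \<and> h = h'"
proof
  assume "row_map R g h = row_map R g' h'"
  from fun_cong[OF this, of "pair \<one> \<zero>"] fun_cong[OF this, of "pair \<zero> \<one>"]
  show "g = g' \<and> h = h'" using assms by simp
qed auto

lemma zero_dual_free2: "\<zero>\<^bsub>dual_module R (free2 R)\<^esub> = row_map R \<zero> \<zero>"
  by (auto simp: Hom_module_def row_map_def fun_eq_iff restrict_def)

lemma carrier_dual_free2: "carrier (dual_module R (free2 R)) = {row_map R g h | g h. g \<in> carrier R \<and> h \<in> carrier R}"
  by (auto simp: Hom_module_def row_map_hom elim: free2_dual_cases)

text \<open>Dualizing turns a matrix acting on columns into the same matrix acting on rows from the right.\<close>

lemma dual_map_mat_map:
  assumes "p \<in> carrier R" "q \<in> carrier R" "r \<in> carrier R" "w \<in> carrier R" "g \<in> carrier R" "h \<in> carrier R"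
  shows "dual_map R (free2 R) (free2 R) (mat_map R p q r w) (row_map R g h)
    = row_map R (g \<otimes> p \<oplus> h \<otimes> r) (g \<otimes> q \<oplus> h \<otimes> w)"
proof -
  have "row_map R g h \<in> carrier (dual_module R (free2 R))" using assms by (auto simp: carrier_dual_free2)
  then have "dual_map R (free2 R) (free2 R) (mat_map R p q r w) (row_map R g h)
    = compose (carrier (free2 R)) (row_map R g h) (mat_map R p q r w)"
    by (simp add: dual_map_def)
  also have "\<dots> = row_map R (g \<otimes> p \<oplus> h \<otimes> r) (g \<otimes> q \<oplus> h \<otimes> w)"
  proof
    fix f
    show "compose (carrier (free2 R)) (row_map R g h) (mat_map R p q r w) f
      = row_map R (g \<otimes> p \<oplus> h \<otimes> r) (g \<otimes> q \<oplus> h \<otimes> w) f"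
    proof (cases "f \<in> carrier (free2 R)")
      case True
      then obtain a b where "a \<in> carrier R" "b \<in> carrier R" "f = pair a b" by auto
      then show ?thesis using assms
        by (auto simp: compose_def r_distr l_distr m_assoc a_ac)
    next
      case False
      then show ?thesis by (simp add: compose_def row_map_def)
    qed
  qed
  finally show ?thesis .
qed

end

section \<open>Exact pairs of adjugate matrices\<close>

text \<open>Over a nontrivial ring, a singular matrix with rows \<open>(p, q)\<close> and \<open>(r, w)\<close> such that the kernels of the matrix and of its adjugate are contained in
the image of the other one.\<close>

locale adjugate_pair = cring R for R :: "('a, 'm) ring_scheme" (structure) +
  fixes p q r w :: 'a
  assumes carr [simp]: "p \<in> carrier R" "q \<in> carrier R" "r \<in> carrier R" "w \<in> carrier R"
    and nontrivial: "\<one> \<noteq> \<zero>"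
    and det: "p \<otimes> w = q \<otimes> r"
    and ker_mat: "\<And>a b. \<lbrakk>a \<in> carrier R; b \<in> carrier R; p \<otimes> a \<oplus> q \<otimes> b = \<zero>; r \<otimes> a \<oplus> w \<otimes> b = \<zero>\<rbrakk> \<Longrightarrow>
      \<exists>c\<in>carrier R. \<exists>d\<in>carrier R. a = w \<otimes> c \<ominus> q \<otimes> d \<and> b = p \<otimes> d \<ominus> r \<otimes> c"
    and ker_adj: "\<And>a b. \<lbrakk>a \<in> carrier R; b \<in> carrier R; w \<otimes> a \<ominus> q \<otimes> b = \<zero>; p \<otimes> b \<ominus> r \<otimes> a = \<zero>\<rbrakk> \<Longrightarrow>
      \<exists>c\<in>carrier R. \<exists>d\<in>carrier R. a = p \<otimes> c \<oplus> q \<otimes> d \<and> b = r \<otimes> c \<oplus> w \<otimes> d"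
begin

abbreviation "mat \<equiv> mat_map R p q r w"
abbreviation "adj \<equiv> mat_map R w (\<ominus> q) (\<ominus> r) p"

text \<open>The entries in the form in which the assumptions on the kernels speak of them.\<close>

lemma adj_pair: "a \<in> carrier R \<Longrightarrow> b \<in> carrier R \<Longrightarrow>
  adj (pair a b) = pair (w \<otimes> a \<ominus> q \<otimes> b) (p \<otimes> b \<ominus> r \<otimes> a)"
  by (simp add: l_minus minus_eq a_comm)

text \<open>The adjugate of the adjugate is the matrix itself, so every fact about the pair also holds with the roles exchanged.\<close>

lemma swapped: "adjugate_pair R w (\<ominus> q) (\<ominus> r) p"
proof (unfold_locales, goal_cases)
  case 6 show ?case using det by (simp add: l_minus r_minus m_comm)
next
  case (7 a b)
  then obtain c d where "c \<in> carrier R" "d \<in> carrier R" "a = p \<otimes> c \<oplus> q \<otimes> d" "b = r \<otimes> c \<oplus> w \<otimes> d"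
    using ker_adj[of a b] by (auto simp: l_minus minus_eq a_comm)
  then show ?case by (intro bexI[of _ c] bexI[of _ d]) (auto simp: l_minus minus_eq a_comm)
next
  case (8 a b)
  then obtain c d where "c \<in> carrier R" "d \<in> carrier R" "a = w \<otimes> c \<ominus> q \<otimes> d" "b = p \<otimes> d \<ominus> r \<otimes> c"
    using ker_mat[of a b] by (auto simp: l_minus minus_eq a_comm)
  then show ?case by (intro bexI[of _ c] bexI[of _ d]) (auto simp: l_minus minus_eq a_comm)
qed (simp_all add: nontrivial)

lemma mat_adj:
  assumes "c \<in> carrier R" "d \<in> carrier R"
  shows "mat (adj (pair c d)) = pair \<zero> \<zero>"
proof -
  have cancel: "A \<ominus> D \<oplus> (D \<ominus> A) = \<zero>" if "A \<in> carrier R" "D \<in> carrier R" for A D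
    using that by (simp add: minus_eq a_assoc r_neg1 r_neg)
  have "p \<otimes> (w \<otimes> c \<ominus> q \<otimes> d) = (p \<otimes> w) \<otimes> c \<ominus> (p \<otimes> q) \<otimes> d"
    using assms by (simp add: minus_eq r_distr r_minus m_assoc)
  moreover have "q \<otimes> (p \<otimes> d \<ominus> r \<otimes> c) = (p \<otimes> q) \<otimes> d \<ominus> (p \<otimes> w) \<otimes> c"
    using assms unfolding det by (simp add: minus_eq r_distr r_minus m_assoc m_lcomm)
  moreover have "r \<otimes> (w \<otimes> c \<ominus> q \<otimes> d) = (r \<otimes> w) \<otimes> c \<ominus> (p \<otimes> w) \<otimes> d"
    using assms unfolding det by (simp add: minus_eq r_distr r_minus m_assoc m_lcomm)
  moreover have "w \<otimes> (p \<otimes> d \<ominus> r \<otimes> c) = (p \<otimes> w) \<otimes> d \<ominus> (r \<otimes> w) \<otimes> c"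
    using assms by (simp add: minus_eq r_distr r_minus m_assoc m_lcomm)
  ultimately show ?thesis using assms unfolding adj_pair[OF assms] by (simp add: cancel)
qed

lemma exact_adj_mat: "exact_at (free2 R) adj (free2 R) mat (free2 R)"
  unfolding exact_at_def a_kernel_def'
proof (intro subset_antisym subsetI)
  fix f assume "f \<in> adj ` carrier (free2 R)"
  then obtain c d where cd: "c \<in> carrier R" "d \<in> carrier R" and f: "f = adj (pair c d)" by auto
  then have "f \<in> carrier (free2 R)" by (auto simp: adj_pair)
  then show "f \<in> {x \<in> carrier (free2 R). mat x = \<zero>\<^bsub>free2 R\<^esub>}" using mat_adj[OF cd] f by simp
next
  fix f assume "f \<in> {x \<in> carrier (free2 R). mat x = \<zero>\<^bsub>free2 R\<^esub>}"
  then obtain a b where ab: "a \<in> carrier R" "b \<in> carrier R" and f: "f = pair a b"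
    and "p \<otimes> a \<oplus> q \<otimes> b = \<zero>" "r \<otimes> a \<oplus> w \<otimes> b = \<zero>" by auto
  then obtain c d where "c \<in> carrier R" "d \<in> carrier R" "a = w \<otimes> c \<ominus> q \<otimes> d" "b = p \<otimes> d \<ominus> r \<otimes> c"
    using ker_mat by blast
  then show "f \<in> adj ` carrier (free2 R)"
    by (intro image_eqI[of _ _ "pair c d"]) (auto simp: f adj_pair simp del: mat_map_pair)
qed

text \<open>Exactness of the dual needs no new assumption. A row \<open>(g, h)\<close> is annihilated by the adjugate iff the
column \<open>(h, - g)\<close> is annihilated by the matrix, because transposition of two-by-two matrices is conjugate to taking adjugates.
If that column is the value of the adjugate at \<open>(c, d)\<close>, then \<open>(g, h)\<close> is the row \<open>(- d, c)\<close> times the matrix.\<close>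

lemma dual_exact_mat_adj:
  "exact_at (dual_module R (free2 R)) (dual_map R (free2 R) (free2 R) mat)
     (dual_module R (free2 R)) (dual_map R (free2 R) (free2 R) adj) (dual_module R (free2 R))"
  unfolding exact_at_def a_kernel_def'
proof (intro subset_antisym subsetI)
  fix \<phi> assume "\<phi> \<in> dual_map R (free2 R) (free2 R) mat ` carrier (dual_module R (free2 R))"
  then obtain g h where gh: "g \<in> carrier R" "h \<in> carrier R"
    and \<phi>: "\<phi> = row_map R (g \<otimes> p \<oplus> h \<otimes> r) (g \<otimes> q \<oplus> h \<otimes> w)"
    by (auto simp: carrier_dual_free2 dual_map_mat_map)
  have "\<phi> \<in> carrier (dual_module R (free2 R))" using gh carr unfolding \<phi> carrier_dual_free2 by blast
  moreover have "dual_map R (free2 R) (free2 R) adj \<phi> = row_map R \<zero> \<zero>"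
  proof -
    let ?G = "g \<otimes> p \<oplus> h \<otimes> r" and ?H = "g \<otimes> q \<oplus> h \<otimes> w"
    have "?G \<otimes> w = g \<otimes> (p \<otimes> w) \<oplus> h \<otimes> (r \<otimes> w)"
      using gh by (simp add: l_distr m_assoc)
    moreover have "?H \<otimes> (\<ominus> r) = \<ominus> (g \<otimes> (p \<otimes> w) \<oplus> h \<otimes> (r \<otimes> w))"
      using gh unfolding det by (simp add: l_distr r_minus m_assoc m_comm[of w r])
    moreover have "?G \<otimes> (\<ominus> q) = \<ominus> (g \<otimes> (p \<otimes> q) \<oplus> h \<otimes> (p \<otimes> w))"
      using gh unfolding det by (simp add: l_distr r_minus m_assoc m_comm[of q r])
    moreover have "?H \<otimes> p = g \<otimes> (p \<otimes> q) \<oplus> h \<otimes> (p \<otimes> w)"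
      using gh by (simp add: l_distr m_assoc m_comm[of q p] m_comm[of w p])
    ultimately show ?thesis using gh by (simp add: \<phi> dual_map_mat_map r_neg l_neg)
  qed
  ultimately show "\<phi> \<in> {x \<in> carrier (dual_module R (free2 R)).
      dual_map R (free2 R) (free2 R) adj x = \<zero>\<^bsub>dual_module R (free2 R)\<^esub>}"
    by (simp add: zero_dual_free2)
next
  fix \<phi> assume "\<phi> \<in> {x \<in> carrier (dual_module R (free2 R)).
      dual_map R (free2 R) (free2 R) adj x = \<zero>\<^bsub>dual_module R (free2 R)\<^esub>}"
  then obtain g h where gh: "g \<in> carrier R" "h \<in> carrier R" and \<phi>: "\<phi> = row_map R g h"
    and eqs: "g \<otimes> w \<oplus> h \<otimes> (\<ominus> r) = \<zero>" "g \<otimes> (\<ominus> q) \<oplus> h \<otimes> p = \<zero>"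
    by (auto simp: carrier_dual_free2 dual_map_mat_map zero_dual_free2 row_map_eq_iff)
  have "p \<otimes> h \<oplus> q \<otimes> (\<ominus> g) = \<zero>" using eqs(2) gh by (simp add: r_minus m_comm a_comm)
  moreover have "r \<otimes> h \<oplus> w \<otimes> (\<ominus> g) = \<ominus> (g \<otimes> w \<oplus> h \<otimes> (\<ominus> r))"
    using gh by (simp add: r_minus m_comm a_comm minus_add)
  ultimately obtain c d where cd: "c \<in> carrier R" "d \<in> carrier R"
    and h: "h = w \<otimes> c \<ominus> q \<otimes> d" and g: "\<ominus> g = p \<otimes> d \<ominus> r \<otimes> c"
    using ker_mat[of h "\<ominus> g"] eqs(1) gh by auto
  have "g = \<ominus> (p \<otimes> d \<ominus> r \<otimes> c)" using gh g by (metis minus_minus)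
  then have "\<phi> = dual_map R (free2 R) (free2 R) mat (row_map R (\<ominus> d) c)"
    using cd by (simp add: \<phi> h dual_map_mat_map l_minus r_minus minus_eq minus_add m_comm a_comm)
  then show "\<phi> \<in> dual_map R (free2 R) (free2 R) mat ` carrier (dual_module R (free2 R))"
    using cd by (auto simp: carrier_dual_free2)
qed

end

context cring
begin

lemma free2_finitely_generated: "finitely_generated_module R (free2 R)"
proof -
  interpret F: plain_module R "free2 R" by (rule plain_module.intro[OF free2_module])
  show ?thesis
    by (rule F.finitely_generated_two[of "pair \<one> \<zero>" "pair \<zero> \<one>"]) auto
qed

lemma free2_free:
  assumes False: "\<one> \<noteq> \<zero>"
  shows "free_module R (free2 R)"
proof -
  interpret F: plain_module R "free2 R" by (rule plain_module.intro[OF free2_module])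
  let ?u = "pair \<one> \<zero>" and ?v = "pair \<zero> \<one>"
  have sum: "(\<Oplus>\<^bsub>free2 R\<^esub>b\<in>{b \<in> {?u, ?v}. c b \<noteq> \<zero>}. c b \<odot>\<^bsub>free2 R\<^esub> b) = pair (c ?u) (c ?v)"
    if c: "c ?u \<in> carrier R" "c ?v \<in> carrier R" for c
  proof -
    have "(\<Oplus>\<^bsub>free2 R\<^esub>b\<in>{b \<in> {?u, ?v}. c b \<noteq> \<zero>}. c b \<odot>\<^bsub>free2 R\<^esub> b) = (\<Oplus>\<^bsub>free2 R\<^esub>b\<in>{?u, ?v}. c b \<odot>\<^bsub>free2 R\<^esub> b)"
      by (rule F.M.add.finprod_mono_neutral_cong_left) (use c in auto)
    also have "\<dots> = pair (c ?u) (c ?v)"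
      using c False by (subst F.M.finsum_insert) (auto simp: F.M.finsum_insert)
    finally show ?thesis .
  qed
  have "module_basis R (free2 R) {?u, ?v}"
    unfolding module_basis_def
  proof (intro conjI ballI)
    fix x assume "x \<in> carrier (free2 R)"
    then obtain a b where ab: "a \<in> carrier R" "b \<in> carrier R" and x: "x = pair a b" by auto
    show "\<exists>!c. c \<in> coefficient_families R {?u, ?v} \<and>
      x = (\<Oplus>\<^bsub>free2 R\<^esub>b\<in>{b \<in> {?u, ?v}. c b \<noteq> \<zero>}. c b \<odot>\<^bsub>free2 R\<^esub> b)"
    proof (rule ex1I[of _ "\<lambda>s\<in>{?u, ?v}. if s = ?u then a else b"], goal_cases)
      case 1
      have "(\<lambda>s\<in>{?u, ?v}. if s = ?u then a else b) \<in> coefficient_families R {?u, ?v}"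
        using ab by (auto simp: coefficient_families_def)
      moreover have "x = pair ((\<lambda>s\<in>{?u, ?v}. if s = ?u then a else b) ?u) ((\<lambda>s\<in>{?u, ?v}. if s = ?u then a else b) ?v)"
        using False by (auto simp: x)
      ultimately show ?case using ab by (subst sum) auto
    next
      case (2 c)
      then have c: "c \<in> {?u, ?v} \<rightarrow>\<^sub>E carrier R" by (simp add: coefficient_families_def)
      then have cuv: "c ?u \<in> carrier R" "c ?v \<in> carrier R" by (auto intro: PiE_mem)
      from 2 sum[OF cuv] have "c ?u = a" "c ?v = b" by (auto simp: x)
      then have "c s = (\<lambda>s\<in>{?u, ?v}. if s = ?u then a else b) s" for s
        using PiE_arb[OF c, of s] False by (cases "s = ?u"; cases "s = ?v") auto
      then show ?case by (rule ext)
    qed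
  qed auto
  then show ?thesis using free2_module by (auto simp: free_module_def)
qed

end

context adjugate_pair
begin

lemma image_mat_iff: "mat ` carrier (free2 R) = {x \<in> carrier (free2 R). adj x = pair \<zero> \<zero>}"
proof -
  interpret A: adjugate_pair R w "\<ominus> q" "\<ominus> r" p by (rule swapped)
  show ?thesis using A.exact_adj_mat by (simp add: exact_at_def a_kernel_def')
qed

lemma image_mat_submodule:
  "subgroup (mat ` carrier (free2 R)) (add_monoid (free2 R))"
  "\<forall>a\<in>carrier R. \<forall>x\<in>mat ` carrier (free2 R). a \<odot>\<^bsub>free2 R\<^esub> x \<in> mat ` carrier (free2 R)"
proof -
  interpret F: plain_module R "free2 R" by (rule plain_module.intro[OF free2_module])
  have hom: "\<And>x y. x \<in> carrier (free2 R) \<Longrightarrow> y \<in> carrier (free2 R) \<Longrightarrow> mat (x \<oplus>\<^bsub>free2 R\<^esub> y) = mat x \<oplus>\<^bsub>free2 R\<^esub> mat y"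
    "\<And>a x. a \<in> carrier R \<Longrightarrow> x \<in> carrier (free2 R) \<Longrightarrow> mat (a \<odot>\<^bsub>free2 R\<^esub> x) = a \<odot>\<^bsub>free2 R\<^esub> mat x"
    "\<And>x. x \<in> carrier (free2 R) \<Longrightarrow> mat x \<in> carrier (free2 R)"
    using mat_map_hom[OF carr] unfolding module_homs_def by blast+
  have "group_hom (add_monoid (free2 R)) (add_monoid (free2 R)) mat"
    by (intro group_hom.intro F.M.a_group group_hom_axioms.intro, rule homI)
      (use hom(1,3) in \<open>simp_all del: free2_simps\<close>)
  from group_hom.img_is_subgroup[OF this]
  show "subgroup (mat ` carrier (free2 R)) (add_monoid (free2 R))" by (simp del: free2_simps)
  show "\<forall>a\<in>carrier R. \<forall>x\<in>mat ` carrier (free2 R). a \<odot>\<^bsub>free2 R\<^esub> x \<in> mat ` carrier (free2 R)"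
  proof (intro ballI)
    fix a x assume a: "a \<in> carrier R" and "x \<in> mat ` carrier (free2 R)"
    then obtain y where y: "y \<in> carrier (free2 R)" "x = mat y" by blast
    then have "a \<odot>\<^bsub>free2 R\<^esub> x = mat (a \<odot>\<^bsub>free2 R\<^esub> y)" using hom(2)[OF a y(1)] by simp
    then show "a \<odot>\<^bsub>free2 R\<^esub> x \<in> mat ` carrier (free2 R)" using F.smult_closed[OF a y(1)] by blast
  qed
qed

abbreviation "coker \<equiv> cokernel (free2 R) (free2 R) mat"

lemma plain_module_free2: "plain_module R (free2 R)"
  by (rule plain_module.intro[OF free2_module])

lemma plain_module_coker: "plain_module R coker"
  unfolding cokernel_def
  by (rule plain_module.intro[OF plain_module.quotient_module_module[OF plain_module_free2 image_mat_submodule]])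

lemma coker_finitely_generated: "finitely_generated_module R coker"
proof -
  interpret F: plain_module R "free2 R" by (rule plain_module_free2)
  note Q = F.carrier_quotient_module[OF image_mat_submodule]
    F.quotient_module_add[OF image_mat_submodule] F.quotient_module_smult[OF image_mat_submodule]
  show ?thesis
    unfolding cokernel_def
  proof (rule plain_module.finitely_generated_two[OF plain_module_coker[unfolded cokernel_def],
        of "mat ` carrier (free2 R) +>\<^bsub>free2 R\<^esub> pair \<one> \<zero>" "mat ` carrier (free2 R) +>\<^bsub>free2 R\<^esub> pair \<zero> \<one>"])
    fix C assume "C \<in> carrier (quotient_module (free2 R) (mat ` carrier (free2 R)))"
    then obtain a b where "a \<in> carrier R" "b \<in> carrier R" "C = mat ` carrier (free2 R) +>\<^bsub>free2 R\<^esub> pair a b"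
      by (auto simp: Q(1))
    then show "\<exists>a\<in>carrier R. \<exists>b\<in>carrier R. C =
        a \<odot>\<^bsub>quotient_module (free2 R) (mat ` carrier (free2 R))\<^esub> (mat ` carrier (free2 R) +>\<^bsub>free2 R\<^esub> pair \<one> \<zero>)
        \<oplus>\<^bsub>quotient_module (free2 R) (mat ` carrier (free2 R))\<^esub>
        b \<odot>\<^bsub>quotient_module (free2 R) (mat ` carrier (free2 R))\<^esub> (mat ` carrier (free2 R) +>\<^bsub>free2 R\<^esub> pair \<zero> \<one>)"
      by (intro bexI[of _ a] bexI[of _ b]) (simp_all add: Q(2,3))
  qed (auto simp: Q(1))
qed

lemma coker_totally_reflexive: "totally_reflexive R coker"
proof -
  interpret A: adjugate_pair R w "\<ominus> q" "\<ominus> r" p by (rule swapped)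
  define d :: "int \<Rightarrow> (nat \<Rightarrow> 'a) \<Rightarrow> nat \<Rightarrow> 'a" where "d = (\<lambda>i. if even i then adj else mat)"
  have "exact_complex R (\<lambda>_. free2 R) d"
    unfolding exact_complex_def
    using exact_adj_mat A.exact_adj_mat mat_map_hom[OF carr] mat_map_hom[of w "\<ominus> q" "\<ominus> r" p]
    by (auto simp: d_def)
  moreover have "dual_complex_exact R (\<lambda>_. free2 R) d"
    unfolding dual_complex_exact_def
    using dual_exact_mat_adj A.dual_exact_mat_adj by (auto simp: d_def)
  moreover have "module_isomorphic R coker (cokernel (free2 R) (free2 R) (d 1))"
    using plain_module.module_isomorphic_self[OF plain_module_coker] by (simp add: d_def)
  ultimately show ?thesis
    unfolding totally_reflexive_def
    using coker_finitely_generated free2_finitely_generated free2_free[OF nontrivial]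
    by (intro conjI exI[of _ "\<lambda>_. free2 R"] exI[of _ d]) auto
qed

text \<open>An element annihilating all entries multiplies every vector into the kernel of the adjugate, hence into the
image of the matrix, so it annihilates the cokernel. The condition on \<open>w\<close> keeps the first unit vector out of that image.\<close>

lemma coker_not_free:
  assumes z: "z \<in> carrier R" "z \<noteq> \<zero>" "z \<otimes> p = \<zero>" "z \<otimes> q = \<zero>" "z \<otimes> r = \<zero>" "z \<otimes> w = \<zero>"
    and w: "w \<noteq> \<zero>"
  shows "\<not> free_module R coker"
proof -
  interpret F: plain_module R "free2 R" by (rule plain_module_free2)
  let ?N = "mat ` carrier (free2 R)"
  note Q = F.carrier_quotient_module[OF image_mat_submodule] F.quotient_module_zero[OF image_mat_submodule]
    F.quotient_module_smult[OF image_mat_submodule] F.coset_eq_self_iff[OF image_mat_submodule]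
  have kill: "pair (z \<otimes> a) (z \<otimes> b) \<in> ?N" if "a \<in> carrier R" "b \<in> carrier R" for a b
  proof -
    have "w \<otimes> (z \<otimes> a) = \<zero>" "p \<otimes> (z \<otimes> b) = \<zero>" "q \<otimes> (z \<otimes> b) = \<zero>" "r \<otimes> (z \<otimes> a) = \<zero>"
      using z that by (simp_all add: m_assoc[symmetric] m_comm[of _ z])
    then show ?thesis using that z(1) unfolding image_mat_iff by (simp add: l_minus)
  qed
  have "pair \<one> \<zero> \<notin> ?N" using w unfolding image_mat_iff by simp
  moreover have u: "pair \<one> \<zero> \<in> carrier (free2 R)" by simp
  ultimately have nonzero: "?N +>\<^bsub>free2 R\<^esub> pair \<one> \<zero> \<noteq> ?N" by (simp only: Q(4) not_False_eq_True)
  have annihilated: "z \<odot>\<^bsub>coker\<^esub> C = \<zero>\<^bsub>coker\<^esub>" if "C \<in> carrier coker" for C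
  proof -
    from that obtain a b where ab: "a \<in> carrier R" "b \<in> carrier R" and C: "C = ?N +>\<^bsub>free2 R\<^esub> pair a b"
      by (auto simp: cokernel_def Q(1))
    have zab: "pair (z \<otimes> a) (z \<otimes> b) \<in> carrier (free2 R)" using ab z(1) by simp
    have "z \<odot>\<^bsub>coker\<^esub> C = ?N +>\<^bsub>free2 R\<^esub> pair (z \<otimes> a) (z \<otimes> b)"
      unfolding C cokernel_def by (subst Q(3)[OF z(1)]) (use ab in simp_all)
    also have "\<dots> = ?N" using kill[OF ab] by (simp only: Q(4)[OF zab])
    finally show ?thesis by (simp add: cokernel_def Q(2))
  qed
  have "?N +>\<^bsub>free2 R\<^esub> pair \<one> \<zero> \<in> carrier coker"
    using u unfolding cokernel_def Q(1) by blast
  moreover have "?N +>\<^bsub>free2 R\<^esub> pair \<one> \<zero> \<noteq> \<zero>\<^bsub>coker\<^esub>"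
    using nonzero by (simp add: cokernel_def Q(2))
  ultimately show ?thesis
    using plain_module.not_free_if_annihilated[OF plain_module_coker z(1,2) annihilated] by blast
qed

end

section \<open>The totally reflexive module\<close>

lemma cls_minus: "cls p \<ominus>\<^bsub>ring_R\<^esub> cls q = cls (p - q)"
  by (simp add: a_minus_def cls_uminus cls_simps)

text \<open>The determinant is \<open>sx * sy\<close> up to products of two \<open>X\<close>'s or two \<open>Y\<close>'s. The two kernel conditions are \<open>kernel_in_image\<close> for
the signs \<open>1\<close> and \<open>- 1\<close>, the latter with the components of vectors exchanged.\<close>

lemma ring_R_adjugate_pair:
  "adjugate_pair (ring_R :: 'k::field mpoly8 set ring) (cls (sx + sy)) (cls (ux + uy)) (cls (uy - ux)) (cls sx)"
proof (unfold_locales, goal_cases)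
  case 5
  have "\<not> vanishing_jet (1 :: 'k mpoly8)" by (simp add: vanishing_jet_def)
  then show ?case by (simp only: cls_simps cls_eq_0_iff not_False_eq_True)
next
  case 6
  have "vanishing_jet ((sx + sy) * sx - (ux + uy) * (uy - ux) :: 'k mpoly8)"
    by (rule vanishing_jetI[where c = 1]; (elim surviving_pairs_cases)?; simp add: quad_mult)
  then show ?case by (simp only: cls_simps cls_eq_iff)
next
  case (7 a b)
  then obtain f g :: "'k mpoly8" where fg: "a = cls f" "b = cls g" by (auto simp: carrier_ring_R)
  from 7(3,4) have "vanishing_jet ((sx + sy) * f + (ux + uy) * g)" "vanishing_jet ((uy - ux) * f + sx * g)"
    by (simp_all only: fg cls_simps cls_eq_0_iff)
  then obtain c d where "vanishing_jet (f - (sx * c - (ux + uy) * d))"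
    "vanishing_jet (g - ((ux - uy) * c + (sx + sy) * d))"
    using kernel_in_image[of 1 f g] by (auto simp only: single_one mult_1)
  moreover have "(ux - uy) * c + (sx + sy) * d = (sx + sy) * d - (uy - ux) * c" by (simp add: algebra_simps)
  ultimately have "a = cls sx \<otimes>\<^bsub>ring_R\<^esub> cls c \<ominus>\<^bsub>ring_R\<^esub> cls (ux + uy) \<otimes>\<^bsub>ring_R\<^esub> cls d"
    "b = cls (sx + sy) \<otimes>\<^bsub>ring_R\<^esub> cls d \<ominus>\<^bsub>ring_R\<^esub> cls (uy - ux) \<otimes>\<^bsub>ring_R\<^esub> cls c"
    by (simp_all only: fg cls_simps cls_minus cls_eq_iff)
  then show ?case using cls_simps(5) by blast
next
  case (8 a b)
  then obtain f g :: "'k mpoly8" where fg: "a = cls f" "b = cls g" by (auto simp: carrier_ring_R)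
  have neg: "Poly_Mapping.single 0 (- 1) * uy = (- uy :: 'k mpoly8)"
    by (simp only: single_uminus single_one mult_minus_left mult_1)
  have "(ux + - uy) * f = - ((uy - ux) * f)" "(- uy - ux) * g = - ((ux + uy) * g)" by (simp_all add: algebra_simps)
  then have "(sx + sy) * g + (ux + - uy) * f = (sx + sy) * g - (uy - ux) * f"
    "(- uy - ux) * g + sx * f = sx * f - (ux + uy) * g" by simp_all
  with 8(3,4) have "vanishing_jet ((sx + sy) * g + (ux + - uy) * f)" "vanishing_jet ((- uy - ux) * g + sx * f)"
    by (simp_all only: fg cls_simps cls_minus cls_eq_0_iff)
  then obtain c d where "vanishing_jet (g - (sx * c - (ux + - uy) * d))"
    "vanishing_jet (f - ((ux - - uy) * c + (sx + sy) * d))"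
    using kernel_in_image[of "- 1" g f] by (auto simp only: neg minus_mult_minus mult_1)
  moreover have "sx * c - (ux + - uy) * d = (uy - ux) * d + sx * c"
    "(ux - - uy) * c + (sx + sy) * d = (sx + sy) * d + (ux + uy) * c" by (simp_all add: algebra_simps)
  ultimately have "a = cls (sx + sy) \<otimes>\<^bsub>ring_R\<^esub> cls d \<oplus>\<^bsub>ring_R\<^esub> cls (ux + uy) \<otimes>\<^bsub>ring_R\<^esub> cls c"
    "b = cls (uy - ux) \<otimes>\<^bsub>ring_R\<^esub> cls d \<oplus>\<^bsub>ring_R\<^esub> cls sx \<otimes>\<^bsub>ring_R\<^esub> cls c"
    by (simp_all only: fg cls_simps cls_eq_iff)
  then show ?case using cls_simps(5) by blast
qed (rule cls_simps(5))+

theorem mainTheorem5: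
  assumes "infinite (UNIV :: 'k::field set)"
  shows "\<not> has_exact_zero_divisors (ring_R :: 'k mpoly8 set ring) \<and>
    (\<exists>M :: ('k mpoly8 set, (nat \<Rightarrow> 'k mpoly8 set) set) module.
       totally_reflexive (ring_R :: 'k mpoly8 set ring) M \<and>
       \<not> free_module (ring_R :: 'k mpoly8 set ring) M)"
proof -
  interpret A: adjugate_pair "ring_R :: 'k mpoly8 set ring" "cls (sx + sy)" "cls (ux + uy)" "cls (uy - ux)" "cls sx"
    by (rule ring_R_adjugate_pair)
  define z :: "'k mpoly8" where "z = pvar X1 * pvar Y1"
  have "quad z X1 Y1 = 1" "quad z X3 Y3 = 0" by (simp_all add: z_def quad_mult)
  moreover have "(X1, Y1) \<in> surviving_pairs" "(X3, Y3) \<in> surviving_pairs" by (simp_all add: surviving_pairs_def)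
  ultimately have "\<not> vanishing_jet z"
    using vanishing_jet_quad[of z] by (metis zero_neq_one)
  moreover have "vanishing_jet (z * h)" if "cst h = 0" for h
    by (rule vanishing_jetI[where c = 0]) (simp_all add: that z_def quad_mult[OF surviving_pairs_neq])
  moreover have "\<not> vanishing_jet (sx :: 'k mpoly8)"
    by (auto simp: vanishing_jet_def intro!: exI[of _ X1])
  ultimately have "\<not> free_module ring_R A.coker"
    by (intro A.coker_not_free[of "cls z"]) (simp_all add: cls_simps cls_eq_0_iff)
  then show ?thesis using no_exact_zero_divisors A.coker_totally_reflexive by blast
qed

end
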